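(* Let $A\in\mathbb{R}^{m\times n}$, $L\in\mathbb{R}^{p\times n}$ with $\mathrm{rank}((A^{\top},L^{\top})^{\top})=r$, let $M=A^{\top}A+L^{\top}L$, and let $A=P_AC_AX^{-1}$, $L=P_LS_LX^{-1}$ be a GSVD of $\{A,L\}$ (in the form given in the context), with $P_A=(p_{A,1},\dots,p_{A,m})$. Let $\sigma_1,\dots,\sigma_l$ be the distinct positive values among the $c_i$ on the diagonal of $\Sigma_A$, and let $\mathcal{G}_j\subseteq\mathbb{R}^m$ be the span of the vectors $p_{A,i}$ with $c_i=\sigma_j$, $1\le j\le l$. Let $b\in\mathbb{R}^m$ be nonzero, run the gGKB process for $(A,M)$ with starting vector $b$, and let $k_t=\min\{k\ge0:\alpha_{k+1}\beta_{k+1}=0\}$ be its terminate step, assumed $\ge1$. Then at the $k_t$-th step the gGKB_GSVD algorithm computes exactly $k_t$ GSVD components, corresponding to the nonzero elements in $\{\mathcal{P}_{\mathcal{G}_1}b,\dots,\mathcal{P}_{\mathcal{G}_l}b\}$. That is: with $J=\{j:\mathcal{P}_{\mathcal{G}_j}b\neq\mathbf{0}\}$, the $k_t$ tuples $\bigl(\bar c_i^{(k_t)},\bar s_i^{(k_t)},\bar p_{A,i}^{(k_t)},\bar x_i^{(k_t)}\bigr)$, $1\le i\le k_t$, produced at step $k=k_t$ (see context) are exact nontrivial GSVD components $(c,s,p_A,x)$ of $\{A,L\}$ (with $x\in\mathcal{R}(M)$), and there is a bijection $\tau:\{1,\dots,k_t\}\to J$ such that $\bar c_i^{(k_t)}=\sigma_{\tau(i)}$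 and $\bar p_{A,i}^{(k_t)}\in\mathcal{G}_{\tau(i)}$ for each $i$.
   Context: $\mathcal{P}_{\mathcal{G}}$ is the Euclidean orthogonal projection onto $\mathcal{G}$; $\mathcal{R}(\cdot)$ is the column space; $M^{\dag}$ is the Moore-Penrose pseudoinverse; $\|v\|_M=(v^{\top}Mv)^{1/2}$, a norm on $\mathcal{R}(M)$. GSVD: a pair of factorizations $A=P_AC_AX^{-1}$, $L=P_LS_LX^{-1}$ with $P_A\in\mathbb{R}^{m\times m}$, $P_L\in\mathbb{R}^{p\times p}$ orthogonal, $X=(x_1,\dots,x_n)\in\mathbb{R}^{n\times n}$ invertible, $C_A=(\Sigma_A\ \ \mathbf{0})\in\mathbb{R}^{m\times n}$, $S_L=(\Sigma_L\ \ \mathbf{0})\in\mathbb{R}^{p\times n}$ (the zero blocks having $n-r$ columns), where $\Sigma_A\in\mathbb{R}^{m\times r}$ and $\Sigma_L\in\mathbb{R}^{p\times r}$ are block diagonal with (possibly rectangular or empty) diagonal blocks $$\Sigma_A:\ I_{q_1},\ C_{q_2},\ \mathbf{0}_{(m-q_1-q_2)\times q_3};\qquad \Sigma_L:\ \mathbf{0}_{(p-r+q_1)\times q_1},\ S_{q_2},\ I_{q_3},$$ with $q_1+q_2+q_3=r$, $C_{q_2}=\mathrm{diag}(c_{q_1+1},\dots,c_{q_1+q_2})$, $1>c_{q_1+1}\ge\cdots\ge c_{q_1+q_2}>0$, $S_{q_2}=\mathrm{diag}(s_{q_1+1},\dots,s_{q_1+q_2})$, $0<s_{q_1+1}\le\cdots\le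 s_{q_1+q_2}<1$, and $\Sigma_A^{\top}\Sigma_A+\Sigma_L^{\top}\Sigma_L=I_r$. Also $c_1=\cdots=c_{q_1}=1$, $c_{q_1+q_2+1}=\cdots=c_r=0$, $s_1=\cdots=s_{q_1}=0$, $s_{q_1+q_2+1}=\cdots=s_r=1$. Tuples are "exact nontrivial GSVD components of $\{A,L\}$" if there is a GSVD of $\{A,L\}$ of this form, with $x_i\in\mathcal{R}(M)$ for $1\le i\le r$, in which each of them equals $(c_i,s_i,p_{A,i},x_i)$ for some $1\le i\le r$. gGKB process (Euclidean inner product on $\mathbb{R}^m$): $v_0=\mathbf{0}$, $\beta_1u_1=b$, and for $i\ge1$ $$\alpha_iv_i=M^{\dag}A^{\top}u_i-\beta_iv_{i-1},\qquad \beta_{i+1}u_{i+1}=Av_i-\alpha_iu_i,$$ where $\alpha_i\ge0,\beta_i\ge0$ are chosen so that $\|v_i\|_M=\|u_i\|_2=1$ (normalization of the right-hand sides). Convention at termination: if $\beta_{k+1}=0$ then $u_{k+1}=\mathbf{0}$, $\alpha_{k+1}=0$ and $v_{k+1}=\mathbf{0}$; if $\alpha_{k+1}=0$ then $v_{k+1}=\mathbf{0}$. Set $U_{k+1}=(u_1,\dots,u_{k+1})$, $V_k=(v_1,\dots,v_k)$, and let $B_k\in\mathbb{R}^{(k+1)\times k}$ be lower bidiagonal with $(B_k)_{ii}=\alpha_i$, $(B_k)_{i+1,i}=\beta_{i+1}$, $1\le i\le k$. gGKB_GSVD algorithm: at step $k$ compute the compact SVD $B_k=Y_k\Theta_kH_k^{\top}$,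 $\Theta_k=\mathrm{diag}(\theta_1^{(k)},\dots,\theta_k^{(k)})$, $\theta_1^{(k)}>\cdots>\theta_k^{(k)}>0$, with columns $y_i^{(k)}$ of $Y_k$ and $h_i^{(k)}$ of $H_k$, and output for $1\le i\le k$ $$\bigl(\bar c_i^{(k)},\bar s_i^{(k)},\bar p_{A,i}^{(k)},\bar x_i^{(k)}\bigr)=\bigl(\theta_i^{(k)},(1-(\theta_i^{(k)})^2)^{1/2},U_{k+1}y_i^{(k)},V_kh_i^{(k)}\bigr).$$ *)

theory Defs
  imports Complex_Main "Jordan_Normal_Form.DL_Rank"
begin

text \<open>
  Matrices and vectors are those of Jordan_Normal_Form, with entries indexed from 0. All families of
  scalars and vectors (c_i, s_i, sigma_j, u_i, v_i, alpha_i, beta_i, theta_i) are functions on nat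
  whose meaningful indices start at 1, so the i-th column of P is \<open>col P (i - 1)\<close>.
\<close>

definition is_pinv :: "real mat \<Rightarrow> real mat \<Rightarrow> bool" where
  "is_pinv M N \<longleftrightarrow>
     N \<in> carrier_mat (dim_col M) (dim_row M) \<and>
     M * N * M = M \<and> N * M * N = N \<and>
     (M * N)\<^sup>T = M * N \<and> (N * M)\<^sup>T = N * M"

definition pinv :: "real mat \<Rightarrow> real mat" where
  "pinv M = (THE N. is_pinv M N)"

definition norm2 :: "real vec \<Rightarrow> real" where
  "norm2 v = sqrt (v \<bullet> v)"

definition norm_wrt :: "real mat \<Rightarrow> real vec \<Rightarrow> real" where
  "norm_wrt M v = sqrt (v \<bullet> (M *\<^sub>v v))"

definition proj_onto :: "real vec set \<Rightarrow> real vec \<Rightarrow> real vec" where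
  "proj_onto G b = (THE w. w \<in> G \<and> (\<forall>g\<in>G. (b - w) \<bullet> g = 0))"

text \<open>The library's \<open>orthogonal_mat\<close> only asks for pairwise orthogonal nonzero columns, so it is
  not used here.\<close>

definition orthonormal_cols :: "real mat \<Rightarrow> bool" where
  "orthonormal_cols Q \<longleftrightarrow> Q\<^sup>T * Q = 1\<^sub>m (dim_col Q)"

text \<open>\<open>diag_block_mat\<close> admits rectangular and empty blocks.\<close>

definition Sigma_A :: "nat \<Rightarrow> nat \<Rightarrow> nat \<Rightarrow> nat \<Rightarrow> (nat \<Rightarrow> real) \<Rightarrow> real mat" where
  "Sigma_A m q1 q2 q3 c =
     diag_block_mat [1\<^sub>m q1, mat_diag q2 (\<lambda>i. c (q1 + 1 + i)), 0\<^sub>m (m - q1 - q2) q3]"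

definition Sigma_L :: "nat \<Rightarrow> nat \<Rightarrow> nat \<Rightarrow> nat \<Rightarrow> (nat \<Rightarrow> real) \<Rightarrow> real mat" where
  "Sigma_L p q1 q2 q3 s =
     diag_block_mat [0\<^sub>m (p + q1 - (q1 + q2 + q3)) q1, mat_diag q2 (\<lambda>i. s (q1 + 1 + i)), 1\<^sub>m q3]"

definition pad_zero_cols :: "nat \<Rightarrow> real mat \<Rightarrow> real mat" where
  "pad_zero_cols d S = four_block_mat S (0\<^sub>m (dim_row S) d) (0\<^sub>m 0 (dim_col S)) (0\<^sub>m 0 d)"

text \<open>The inequalities \<open>q1 + q2 \<le> m\<close> and \<open>r \<le> p + q1\<close> say that the zero blocks of \<open>Sigma_A\<close> and
  \<open>Sigma_L\<close> have a nonnegative number of rows (subtraction on nat truncates).\<close>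

definition is_GSVD ::
  "nat \<Rightarrow> nat \<Rightarrow> nat \<Rightarrow> nat \<Rightarrow> real mat \<Rightarrow> real mat \<Rightarrow> nat \<Rightarrow> nat \<Rightarrow> nat \<Rightarrow>
   (nat \<Rightarrow> real) \<Rightarrow> (nat \<Rightarrow> real) \<Rightarrow> real mat \<Rightarrow> real mat \<Rightarrow> real mat \<Rightarrow> bool" where
  "is_GSVD m p n r A L q1 q2 q3 c s PA PL X \<longleftrightarrow>
     q1 + q2 + q3 = r \<and> r \<le> n \<and> q1 + q2 \<le> m \<and> r \<le> p + q1 \<and>
     PA \<in> carrier_mat m m \<and> orthonormal_cols PA \<and>
     PL \<in> carrier_mat p p \<and> orthonormal_cols PL \<and>
     X \<in> carrier_mat n n \<and>
     (\<exists>Xi \<in> carrier_mat n n. inverts_mat X Xi \<and> inverts_mat Xi X \<and>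
        A = PA * pad_zero_cols (n - r) (Sigma_A m q1 q2 q3 c) * Xi \<and>
        L = PL * pad_zero_cols (n - r) (Sigma_L p q1 q2 q3 s) * Xi) \<and>
     (\<forall>i\<in>{1..q1}. c i = 1 \<and> s i = 0) \<and>
     (\<forall>i\<in>{q1 + 1..q1 + q2}. 0 < c i \<and> c i < 1 \<and> 0 < s i \<and> s i < 1) \<and>
     (\<forall>i\<in>{q1 + 1..q1 + q2}. \<forall>j\<in>{i..q1 + q2}. c j \<le> c i \<and> s i \<le> s j) \<and>
     (\<forall>i\<in>{q1 + q2 + 1..r}. c i = 0 \<and> s i = 1) \<and>
     (Sigma_A m q1 q2 q3 c)\<^sup>T * Sigma_A m q1 q2 q3 c
       + (Sigma_L p q1 q2 q3 s)\<^sup>T * Sigma_L p q1 q2 q3 s = 1\<^sub>m r"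

text \<open>All the tuples in \<open>T\<close> come from one and the same GSVD. The bound \<open>i \<le> m\<close> only excludes the
  indices for which \<open>P_A\<close> has no i-th column (there \<open>c_i = 0\<close>).\<close>

definition exact_nontrivial_GSVD_components ::
  "nat \<Rightarrow> nat \<Rightarrow> nat \<Rightarrow> nat \<Rightarrow> real mat \<Rightarrow> real mat \<Rightarrow> (real \<times> real \<times> real vec \<times> real vec) set \<Rightarrow> bool"
where
  "exact_nontrivial_GSVD_components m p n r A L T \<longleftrightarrow>
     (\<exists>q1 q2 q3 c s PA PL X.
        is_GSVD m p n r A L q1 q2 q3 c s PA PL X \<and>
        (\<forall>i\<in>{1..r}. col X (i - 1) \<in> vec_space.col_space n (A\<^sup>T * A + L\<^sup>T * L)) \<and>
        (\<forall>t\<in>T. \<exists>i\<in>{1..r}. i \<le> m \<and> t = (c i, s i, col PA (i - 1), col X (i - 1))))"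

text \<open>The recurrences are required for every \<open>i \<ge> 1\<close>, also past termination: the conventions there
  satisfy them trivially and make all later quantities vanish.\<close>

definition gGKB ::
  "nat \<Rightarrow> nat \<Rightarrow> real mat \<Rightarrow> real mat \<Rightarrow> real vec \<Rightarrow>
   (nat \<Rightarrow> real vec) \<Rightarrow> (nat \<Rightarrow> real vec) \<Rightarrow> (nat \<Rightarrow> real) \<Rightarrow> (nat \<Rightarrow> real) \<Rightarrow> bool" where
  "gGKB m n A M b u v \<alpha> \<beta> \<longleftrightarrow>
     (\<forall>i\<ge>1. u i \<in> carrier_vec m \<and> v i \<in> carrier_vec n \<and> 0 \<le> \<alpha> i \<and> 0 \<le> \<beta> i) \<and>
     v 0 = 0\<^sub>v n \<and>
     \<beta> 1 \<cdot>\<^sub>v u 1 = b \<and>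
     (\<forall>i\<ge>1. \<alpha> i \<cdot>\<^sub>v v i = pinv M *\<^sub>v (A\<^sup>T *\<^sub>v u i) - \<beta> i \<cdot>\<^sub>v v (i - 1)) \<and>
     (\<forall>i\<ge>1. \<beta> (i + 1) \<cdot>\<^sub>v u (i + 1) = A *\<^sub>v v i - \<alpha> i \<cdot>\<^sub>v u i) \<and>
     (\<forall>i\<ge>1. if \<beta> i = 0 then u i = 0\<^sub>v m \<and> \<alpha> i = 0 else norm2 (u i) = 1) \<and>
     (\<forall>i\<ge>1. if \<alpha> i = 0 then v i = 0\<^sub>v n else norm_wrt M (v i) = 1)"

definition terminate_step :: "(nat \<Rightarrow> real) \<Rightarrow> (nat \<Rightarrow> real) \<Rightarrow> nat" where
  "terminate_step \<alpha> \<beta> = (LEAST k. \<alpha> (k + 1) * \<beta> (k + 1) = 0)"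

definition bidiag :: "nat \<Rightarrow> (nat \<Rightarrow> real) \<Rightarrow> (nat \<Rightarrow> real) \<Rightarrow> real mat" where
  "bidiag k \<alpha> \<beta> = mat (k + 1) k
     (\<lambda>(i, j). if i = j then \<alpha> (j + 1) else if i = j + 1 then \<beta> (j + 2) else 0)"

text \<open>\<open>seq_mat d w k\<close> is the \<open>d \<times> k\<close> matrix with columns \<open>w 1, \<dots>, w k\<close>.\<close>

definition seq_mat :: "nat \<Rightarrow> (nat \<Rightarrow> real vec) \<Rightarrow> nat \<Rightarrow> real mat" where
  "seq_mat d w k = mat_of_cols d (map w [1..<k + 1])"

definition is_compact_SVD ::
  "nat \<Rightarrow> real mat \<Rightarrow> real mat \<Rightarrow> (nat \<Rightarrow> real) \<Rightarrow> real mat \<Rightarrow> bool" where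
  "is_compact_SVD k B Y \<theta> H \<longleftrightarrow>
     Y \<in> carrier_mat (dim_row B) k \<and> orthonormal_cols Y \<and>
     H \<in> carrier_mat (dim_col B) k \<and> orthonormal_cols H \<and>
     B = Y * mat_diag k (\<lambda>i. \<theta> (i + 1)) * H\<^sup>T \<and>
     (\<forall>i\<in>{1..k}. 0 < \<theta> i) \<and>
     (\<forall>i\<in>{1..k}. \<forall>j\<in>{1..k}. i < j \<longrightarrow> \<theta> j < \<theta> i)"

definition gGKB_GSVD_tuple ::
  "nat \<Rightarrow> nat \<Rightarrow> nat \<Rightarrow> (nat \<Rightarrow> real vec) \<Rightarrow> (nat \<Rightarrow> real vec) \<Rightarrow>
   real mat \<Rightarrow> (nat \<Rightarrow> real) \<Rightarrow> real mat \<Rightarrow> nat \<Rightarrow> real \<times> real \<times> real vec \<times> real vec" where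
  "gGKB_GSVD_tuple m n k u v Y \<theta> H i =
     (\<theta> i, sqrt (1 - (\<theta> i)\<^sup>2),
      seq_mat m u (k + 1) *\<^sub>v col Y (i - 1),
      seq_mat n v k *\<^sub>v col H (i - 1))"

definition pA_span :: "nat \<Rightarrow> nat \<Rightarrow> (nat \<Rightarrow> real) \<Rightarrow> real mat \<Rightarrow> real \<Rightarrow> real vec set" where
  "pA_span m r c PA \<sigma> =
     LinearCombinations.module.span class_ring (module_vec TYPE(real) m)
       {col PA (i - 1) | i. i \<in> {1..r} \<and> c i = \<sigma>}"

end

(*
  Any GSVD gives K := A M^+ A^T = P_A diag(c_i^2) P_A^T, so that the G_j are the eigenspaces of K for
  its nonzero eigenvalues sigma_j^2. At termination the gGKB relations close up, A V = U B and
  M^+ A^T U = V B^T, hence every singular triple (theta, y, h) of B yields p = U y and x = V h with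
  A x = theta p and M^+ A^T p = theta x: p is a unit eigenvector of K in one of the G_j, and distinct
  theta give distinct j. Since B is unreduced bidiagonal, y has a nonzero first entry, which makes
  p . b nonzero. Conversely a projection g of b onto some G_j that is missed would satisfy
  U^T K g = 0, contradicting u_1 . g <> 0.

  The vectors p become columns of one GSVD by applying, for each p, the same Householder reflection
  inside an eigenspace of K to P_A, P_L and X; projecting the x_i onto R(M) afterwards only adds
  elements of the common kernel of M, A and L.
*)

theory Submission
  imports Defs
begin

text \<open>The given GSVD need not contain the computed vectors: when a value of \<open>c\<close>
  is repeated, \<open>p\<close> is in general a combination of several columns of \<open>PA\<close>,
  and all tuples must come from one common GSVD. Completing the vectors \<open>p\<close> to a new
  orthonormal basis would leave \<open>PL\<close> and \<open>X\<close> to be adjusted separately. A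
  reflection differs from the identity by a rank-one term and is its own inverse, so it can be
  passed through the rectangular diagonal blocks by looking at one pair of singular vectors.
  \<open>X\<close> is never steered towards the computed \<open>x\<close>. Once its first
  \<open>r\<close> columns lie in the range of \<open>M\<close>, M^+ A^T p = c x determines them
  wherever c > 0, and the computed \<open>x\<close> satisfies the same relation. Two degeneracies
  shape the details. \<open>M\<close> may be singular, and M M^+ A^T = A^T takes the place of
  invertibility. The process may stop with \<open>\<beta> (kt + 1) = 0\<close>; then the last column
  of \<open>U\<close> is zero and \<open>U\<close> is not an isometry, but it still acts as one on
  the vectors \<open>y\<close>.\<close>

section \<open>Matrix algebra with plain dimension equations as side conditions\<close>

lemma mat_mult_assoc:
  "dim_col A = dim_row B \<Longrightarrow> dim_col B = dim_row C \<Longrightarrow> A * B * C = A * (B * C :: 'a :: semiring_0 mat)"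
  by (rule assoc_mult_mat) auto

lemma mat_vec_assoc:
  "dim_col A = dim_row B \<Longrightarrow> dim_col B = dim_vec v \<Longrightarrow> (A * B) *\<^sub>v v = A *\<^sub>v (B *\<^sub>v v :: 'a :: semiring_0 vec)"
  by (rule assoc_mult_mat_vec) (auto intro: carrier_vecI)

lemma mat_mult_transpose:
  "dim_col A = dim_row B \<Longrightarrow> (A * B)\<^sup>T = B\<^sup>T * (A\<^sup>T :: 'a :: comm_semiring_0 mat)"
  by (rule transpose_mult) auto

lemma mat_vec_adjoint:
  "dim_vec v = dim_col A \<Longrightarrow> dim_vec w = dim_row A \<Longrightarrow> (A *\<^sub>v v) \<bullet> w = v \<bullet> (A\<^sup>T *\<^sub>v w :: 'a :: comm_ring_1 vec)"
  using transpose_vec_mult_scalar[of A "dim_row A" "dim_col A" v w]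
    comm_scalar_prod[of "A *\<^sub>v v" "dim_row A" w] comm_scalar_prod[of v "dim_col A" "A\<^sup>T *\<^sub>v w"]
  by (metis carrier_matI carrier_vecI dim_mult_mat_vec index_transpose_mat(2))

lemma mat_mult_add:
  "dim_row B = dim_col A \<Longrightarrow> dim_row C = dim_col A \<Longrightarrow> dim_col C = dim_col B \<Longrightarrow>
    A * (B + C) = A * B + A * (C :: 'a :: semiring_0 mat)"
  by (rule mult_add_distrib_mat) auto

lemma mat_add_mult:
  "dim_row C = dim_col A \<Longrightarrow> dim_row B = dim_row A \<Longrightarrow> dim_col B = dim_col A \<Longrightarrow>
    (A + B) * C = A * C + B * (C :: 'a :: semiring_0 mat)"
  by (rule add_mult_distrib_mat) auto

lemma mat_mult_minus:
  "dim_row B = dim_col A \<Longrightarrow> dim_row C = dim_col A \<Longrightarrow> dim_col C = dim_col B \<Longrightarrow>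
    A * (B - C) = A * B - A * (C :: 'a :: ring mat)"
  by (rule mult_minus_distrib_mat) auto

lemma mat_minus_mult:
  "dim_row C = dim_col A \<Longrightarrow> dim_row B = dim_row A \<Longrightarrow> dim_col B = dim_col A \<Longrightarrow>
    (A - B) * C = A * C - B * (C :: 'a :: ring mat)"
  by (rule minus_mult_distrib_mat) auto

lemma mat_mult_one: "dim_col A = n \<Longrightarrow> A * 1\<^sub>m n = (A :: 'a :: semiring_1 mat)"
  by (rule right_mult_one_mat) auto

lemma one_mat_mult: "dim_row A = n \<Longrightarrow> 1\<^sub>m n * A = (A :: 'a :: semiring_1 mat)"
  by (rule left_mult_one_mat) auto

lemma mat_vec_zero: "dim_col A = n \<Longrightarrow> A *\<^sub>v 0\<^sub>v n = (0\<^sub>v (dim_row A) :: 'a :: semiring_0 vec)"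
  by (rule eq_vecI) (auto intro: scalar_prod_right_zero)

lemma scalar_prod_self_eq_0:
  "(v :: real vec) \<bullet> v = 0 \<Longrightarrow> v \<in> carrier_vec n \<Longrightarrow> v = 0\<^sub>v n"
  using conjugate_square_eq_0_vec[of v n] by (simp add: conjugate_vec_def conjugate_real_def vec_eq_iff)

section \<open>Pseudoinverses of Gram matrices\<close>

text \<open>\<open>M * N1\<close> and \<open>M * N2\<close> are symmetric projections onto the same
  column space: each absorbs the other, and transposing one absorption makes them equal. The same
  holds for \<open>N1 * M\<close> and \<open>N2 * M\<close>, and these two equalities turn N1 M N1
  into N2 M N2.\<close>

lemma is_pinv_unique:
  assumes "is_pinv M N1" "is_pinv M N2"
  shows "N1 = N2"
proof -
  have d [simp]: "dim_row N1 = dim_col M" "dim_col N1 = dim_row M"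
      "dim_row N2 = dim_col M" "dim_col N2 = dim_row M"
    using assms by (auto simp: is_pinv_def)
  note s1 = assms(1)[unfolded is_pinv_def]
  note s2 = assms(2)[unfolded is_pinv_def]
  have l: "M * N1 = M * N2"
  proof -
    have "M * N1 = (M * N2) * (M * N1)" using s2 by (simp flip: mat_mult_assoc)
    also have "\<dots> = ((M * N1) * (M * N2))\<^sup>T" using s1 s2 by (simp add: mat_mult_transpose del: transpose_mat_eq)
    also have "(M * N1) * (M * N2) = M * N2" using s1 by (simp flip: mat_mult_assoc)
    finally show ?thesis using s2 by simp
  qed
  have r: "N1 * M = N2 * M"
  proof -
    have "N1 * M = (N1 * M) * (N2 * M)" using s2 by (simp add: mat_mult_assoc)
    also have "\<dots> = ((N2 * M) * (N1 * M))\<^sup>T" using s1 s2 by (simp add: mat_mult_transpose del: transpose_mat_eq)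
    also have "(N2 * M) * (N1 * M) = N2 * M" using s1 by (simp add: mat_mult_assoc)
    finally show ?thesis using s2 by simp
  qed
  have "N1 = (N1 * M) * N1" using s1 by simp
  also have "\<dots> = N2 * (M * N1)" by (simp add: r mat_mult_assoc)
  also have "\<dots> = N2 * M * N2" by (simp add: l mat_mult_assoc)
  finally show ?thesis using s2 by simp
qed

lemma pinv_eqI: "is_pinv M N \<Longrightarrow> pinv M = N"
  unfolding pinv_def by (rule the_equality) (auto intro: is_pinv_unique)

text \<open>Full row rank makes \<open>S = E * E\<^sup>T\<close> invertible, with inverse
  \<open>G\<close>. The pseudoinverse is then E^T G^2 E, since its product with E^T E is the
  symmetric matrix E^T G E on either side. In the application \<open>E\<close> consists of the first
  \<open>r\<close> rows of the inverse of \<open>X\<close>.\<close>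

lemma pinv_gram:
  fixes E R :: "real mat"
  assumes E: "E \<in> carrier_mat r n" and R: "R \<in> carrier_mat n r" and ER: "E * R = 1\<^sub>m r"
  shows "is_pinv (E\<^sup>T * E) (pinv (E\<^sup>T * E))" and "E * pinv (E\<^sup>T * E) * E\<^sup>T = 1\<^sub>m r"
proof -
  have d [simp]: "dim_row E = r" "dim_col E = n" "dim_row R = n" "dim_col R = r" using carrier_matD[OF E] carrier_matD[OF R] by auto
  define S where "S = E * E\<^sup>T"
  have S: "S \<in> carrier_mat r r" unfolding S_def using E by simp
  have "det S \<noteq> 0"
  proof
    assume "det S = 0"
    then obtain z where z: "z \<in> carrier_vec r" "z \<noteq> 0\<^sub>v r" "S *\<^sub>v z = 0\<^sub>v r"
      using det_0_iff_vec_prod_zero_field[OF S] by auto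
    have [simp]: "dim_vec z = r" using z by auto
    have "(E\<^sup>T *\<^sub>v z) \<bullet> (E\<^sup>T *\<^sub>v z) = z \<bullet> (S *\<^sub>v z)"
      by (simp add: mat_vec_adjoint S_def mat_vec_assoc)
    also have "\<dots> = 0" using z by simp
    finally have z0: "E\<^sup>T *\<^sub>v z = 0\<^sub>v n" by (rule scalar_prod_self_eq_0) (auto intro: carrier_vecI)
    have "R\<^sup>T *\<^sub>v (E\<^sup>T *\<^sub>v z) = 0\<^sub>v r" unfolding z0 by (simp add: mat_vec_zero)
    moreover have "R\<^sup>T *\<^sub>v (E\<^sup>T *\<^sub>v z) = (E * R)\<^sup>T *\<^sub>v z"
      by (simp add: mat_mult_transpose mat_vec_assoc)
    ultimately show False using z by (simp add: ER)
  qed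
  then obtain G where G: "G \<in> carrier_mat r r" "G * S = 1\<^sub>m r" "S * G = 1\<^sub>m r"
    using det_non_zero_imp_unit[OF S] by (auto simp: Units_def ring_mat_def)
  have [simp]: "dim_row G = r" "dim_col G = r" "dim_row S = r" "dim_col S = r" using G carrier_matD[OF S] by auto
  have St: "S\<^sup>T = S" by (simp add: S_def mat_mult_transpose)
  have Gt: "G\<^sup>T = G"
  proof -
    have "G\<^sup>T = G\<^sup>T * (S * G)" using G by simp
    also have "\<dots> = (S * G)\<^sup>T * G" by (simp add: mat_mult_transpose St mat_mult_assoc)
    finally show ?thesis using G by simp
  qed
  have c1: "E * (E\<^sup>T * (G * Z)) = Z" if "dim_row Z = r" for Z
  proof -
    have "E * (E\<^sup>T * (G * Z)) = (S * G) * Z" using that by (simp add: S_def mat_mult_assoc)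
    then show ?thesis using that by (simp add: G one_mat_mult)
  qed
  have c2: "G * (E * (E\<^sup>T * Z)) = Z" if "dim_row Z = r" for Z
  proof -
    have "G * (E * (E\<^sup>T * Z)) = (G * S) * Z" using that by (simp add: S_def mat_mult_assoc)
    then show ?thesis using that by (simp add: G one_mat_mult)
  qed
  have p: "is_pinv (E\<^sup>T * E) (E\<^sup>T * (G * (G * E)))"
    unfolding is_pinv_def by (auto simp: mat_mult_assoc mat_mult_transpose c1 c2 Gt)
  have e: "pinv (E\<^sup>T * E) = E\<^sup>T * (G * (G * E))" by (rule pinv_eqI[OF p])
  show "is_pinv (E\<^sup>T * E) (pinv (E\<^sup>T * E))" using p e by simp
  show "E * pinv (E\<^sup>T * E) * E\<^sup>T = 1\<^sub>m r"
    unfolding e using G by (simp add: mat_mult_assoc c1 S_def)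
qed

section \<open>The matrices of a GSVD\<close>

text \<open>Padding by zero columns becomes right multiplication by this matrix, so the padded
  blocks of a GSVD are ordinary factors, and \<open>sel r n * Xi\<close> is the full-row-rank factor
  of \<open>M\<close>.\<close>

definition sel :: "nat \<Rightarrow> nat \<Rightarrow> real mat" where
  "sel r n = mat r n (\<lambda>(i, j). if i = j then 1 else 0)"

lemma sel_dim [simp]: "dim_row (sel r n) = r" "dim_col (sel r n) = n" "sel r n \<in> carrier_mat r n"
  by (auto simp: sel_def)

lemma sel_mult_transpose: "r \<le> n \<Longrightarrow> sel r n * (sel r n)\<^sup>T = 1\<^sub>m r"
  by (rule eq_matI) (auto simp: sel_def scalar_prod_def if_distrib cong: if_cong)

lemma pad_zero_cols_sel: "S \<in> carrier_mat k r \<Longrightarrow> pad_zero_cols d S = S * sel r (r + d)"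
  by (rule eq_matI) (auto simp: sel_def pad_zero_cols_def scalar_prod_def if_distrib cong: if_cong)

lemma Sigma_A_eq:
  assumes "q1 + q2 \<le> m" "\<forall>i\<in>{1..q1}. c i = 1"
  shows "Sigma_A m q1 q2 q3 c = mat m (q1 + q2 + q3) (\<lambda>(i, j). if i = j \<and> j < q1 + q2 then c (j + 1) else 0)"
  using assms
  by (intro eq_matI) (auto simp: Sigma_A_def Let_def mat_diag_def)

text \<open>The leading zero block has p + q1 - r rows and q1 columns, so the diagonal behind it is
  shifted by p - r, which may be negative. The condition \<open>i + r = j + p\<close> states the
  shift without truncated subtraction.\<close>

lemma Sigma_L_eq:
  assumes "r \<le> p + q1" "\<forall>i\<in>{q1 + q2 + 1..r}. s i = 1" and r: "r = q1 + q2 + q3"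
  shows "Sigma_L p q1 q2 q3 s = mat p r (\<lambda>(i, j). if i + r = j + p \<and> q1 \<le> j then s (j + 1) else 0)"
proof -
  have s1: "s (Suc j) = 1" if "q1 + q2 \<le> j" "j < r" for j using assms(2) that by auto
  define k where "k = p + q1 - r"
  have k: "p = k + q2 + q3" "p + q1 - (q1 + q2 + q3) = k" using assms(1) by (auto simp: k_def r)
  show ?thesis
    unfolding Sigma_L_def k(2) k(1)
  proof (rule eq_matI, goal_cases)
    case (1 i j)
    then show ?case
      using s1[of j]
      by (cases "j < q1"; cases "j < q1 + q2"; cases "i < k"; cases "i < k + q2") (auto simp: Let_def mat_diag_def r)
  qed (auto simp: Let_def mat_diag_def r)
qed

context
  fixes m p n r q1 q2 q3 :: nat and A L PA PL X :: "real mat" and c s :: "nat \<Rightarrow> real"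
  assumes gsvd: "is_GSVD m p n r A L q1 q2 q3 c s PA PL X"
begin

lemma GSVD_dims:
  "r = q1 + q2 + q3" "r \<le> n" "q1 + q2 \<le> m" "r \<le> p + q1"
  "PA \<in> carrier_mat m m" "PL \<in> carrier_mat p p" "X \<in> carrier_mat n n"
  using gsvd by (auto simp: is_GSVD_def)

lemma GSVD_Sigma_A:
  "Sigma_A m q1 q2 q3 c = mat m r (\<lambda>(i, j). if i = j \<and> j < q1 + q2 then c (j + 1) else 0)"
  using gsvd Sigma_A_eq[of q1 q2 m c q3] by (auto simp: is_GSVD_def)

lemma GSVD_Sigma_L:
  "Sigma_L p q1 q2 q3 s = mat p r (\<lambda>(i, j). if i + r = j + p \<and> q1 \<le> j then s (j + 1) else 0)"
  using gsvd by (intro Sigma_L_eq) (auto simp: is_GSVD_def)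

lemma GSVD_PA: "PA\<^sup>T * PA = 1\<^sub>m m" "PA * PA\<^sup>T = 1\<^sub>m m"
proof -
  show "PA\<^sup>T * PA = 1\<^sub>m m" using gsvd by (auto simp: is_GSVD_def orthonormal_cols_def)
  then show "PA * PA\<^sup>T = 1\<^sub>m m" using GSVD_dims by (intro mat_mult_left_right_inverse[of "PA\<^sup>T"]) auto
qed

lemma GSVD_PL: "PL\<^sup>T * PL = 1\<^sub>m p"
  using gsvd by (auto simp: is_GSVD_def orthonormal_cols_def)

lemma GSVD_c_pos: "i \<in> {1..q1 + q2} \<Longrightarrow> 0 < c i"
  using gsvd by (cases "i \<le> q1") (auto simp: is_GSVD_def)

lemma GSVD_c_zero: "i \<in> {q1 + q2 + 1..r} \<Longrightarrow> c i = 0"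
  using gsvd by (auto simp: is_GSVD_def)

lemma GSVD_s_nonneg: "i \<in> {1..r} \<Longrightarrow> 0 \<le> s i"
  using gsvd by (cases "i \<le> q1"; cases "i \<le> q1 + q2") (auto simp: is_GSVD_def less_imp_le)

lemma GSVD_gram:
  "(Sigma_A m q1 q2 q3 c)\<^sup>T * Sigma_A m q1 q2 q3 c + (Sigma_L p q1 q2 q3 s)\<^sup>T * Sigma_L p q1 q2 q3 s = 1\<^sub>m r"
  using gsvd by (auto simp: is_GSVD_def)

text \<open>Since \<open>s\<close> is a function of \<open>c\<close>, it is constant on any set of
  indices that share a value of \<open>c\<close>; this lets one coefficient vector reflect both
  factorizations. It also identifies the second entry of the output tuples. Only the middle block
  needs the Gram identity, read at a diagonal position.\<close>

lemma GSVD_s_eq: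
  assumes i: "i \<in> {1..r}"
  shows "s i = sqrt (1 - (c i)\<^sup>2)"
proof -
  consider "i \<le> q1" | "q1 < i" "i \<le> q1 + q2" | "q1 + q2 < i" by linarith
  then show ?thesis
  proof cases
    case 2
    obtain j where j: "i = j + 1" using i by (cases i) auto
    have jr: "j < r" "j < m" "j + p - r < p" "j + p - r + r = j + p" using 2 GSVD_dims j by auto
    have "((Sigma_A m q1 q2 q3 c)\<^sup>T * Sigma_A m q1 q2 q3 c
        + (Sigma_L p q1 q2 q3 s)\<^sup>T * Sigma_L p q1 q2 q3 s) $$ (j, j) = (1\<^sub>m r) $$ (j, j)"
      using GSVD_gram by simp
    moreover have "((Sigma_A m q1 q2 q3 c)\<^sup>T * Sigma_A m q1 q2 q3 c) $$ (j, j) = (c i)\<^sup>2"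
      using jr 2 unfolding GSVD_Sigma_A
      by (simp add: scalar_prod_def j power2_eq_square if_distrib[of "\<lambda>x. x * _"] if_distrib[of "\<lambda>x. _ * x"] cong: if_cong)
    moreover have "((Sigma_L p q1 q2 q3 s)\<^sup>T * Sigma_L p q1 q2 q3 s) $$ (j, j) = (s i)\<^sup>2"
    proof -
      have "((Sigma_L p q1 q2 q3 s)\<^sup>T * Sigma_L p q1 q2 q3 s) $$ (j, j) =
          (\<Sum>k = 0..<p. Sigma_L p q1 q2 q3 s $$ (k, j) * Sigma_L p q1 q2 q3 s $$ (k, j))"
        using jr by (simp add: scalar_prod_def GSVD_Sigma_L)
      also have "\<dots> = (\<Sum>k = 0..<p. if k = j + p - r then (s i)\<^sup>2 else 0)"
        by (rule sum.cong) (use jr 2 in \<open>auto simp: GSVD_Sigma_L j power2_eq_square\<close>)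
      finally have "((Sigma_L p q1 q2 q3 s)\<^sup>T * Sigma_L p q1 q2 q3 s) $$ (j, j) =
          (\<Sum>k = 0..<p. if k = j + p - r then (s i)\<^sup>2 else 0)" .
      then show ?thesis using jr by simp
    qed
    moreover have "dim_row (Sigma_L p q1 q2 q3 s) = p" "dim_col (Sigma_L p q1 q2 q3 s) = r"
      unfolding GSVD_Sigma_L by auto
    ultimately have "(c i)\<^sup>2 + (s i)\<^sup>2 = 1" using jr by simp
    then have "(s i)\<^sup>2 = 1 - (c i)\<^sup>2" by simp
    then show ?thesis using GSVD_s_nonneg[OF i] by (metis real_sqrt_unique)
  qed (use gsvd i in \<open>auto simp: is_GSVD_def\<close>)
qed

lemma GSVD_obtain:
  obtains Xi where "Xi \<in> carrier_mat n n" "X * Xi = 1\<^sub>m n" "Xi * X = 1\<^sub>m n"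
    "A = PA * (Sigma_A m q1 q2 q3 c * (sel r n * Xi))"
    "L = PL * (Sigma_L p q1 q2 q3 s * (sel r n * Xi))"
proof -
  obtain Xi where Xi: "Xi \<in> carrier_mat n n" "inverts_mat X Xi" "inverts_mat Xi X"
        "A = PA * pad_zero_cols (n - r) (Sigma_A m q1 q2 q3 c) * Xi"
        "L = PL * pad_zero_cols (n - r) (Sigma_L p q1 q2 q3 s) * Xi"
    using gsvd by (auto simp: is_GSVD_def)
  have a: "pad_zero_cols (n - r) (Sigma_A m q1 q2 q3 c) = Sigma_A m q1 q2 q3 c * sel r n"
    using GSVD_dims by (subst pad_zero_cols_sel[of _ m r]) (auto simp: GSVD_Sigma_A)
  have l: "pad_zero_cols (n - r) (Sigma_L p q1 q2 q3 s) = Sigma_L p q1 q2 q3 s * sel r n"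
    using GSVD_dims by (subst pad_zero_cols_sel[of _ p r]) (auto simp: GSVD_Sigma_L)
  note d = carrier_matD[OF Xi(1)] carrier_matD[OF GSVD_dims(5)] carrier_matD[OF GSVD_dims(6)] carrier_matD[OF GSVD_dims(7)]
  show thesis
  proof
    show "A = PA * (Sigma_A m q1 q2 q3 c * (sel r n * Xi))"
      unfolding Xi(4) a by (simp add: mat_mult_assoc d GSVD_Sigma_A)
    show "L = PL * (Sigma_L p q1 q2 q3 s * (sel r n * Xi))"
      unfolding Xi(5) l by (simp add: mat_mult_assoc d GSVD_Sigma_L)
  qed (use Xi d in \<open>auto simp: inverts_mat_def\<close>)
qed

lemma GSVD_normal_matrix:
  assumes Xi: "Xi \<in> carrier_mat n n"
    "A = PA * (Sigma_A m q1 q2 q3 c * (sel r n * Xi))"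
    "L = PL * (Sigma_L p q1 q2 q3 s * (sel r n * Xi))"
  shows "A\<^sup>T * A + L\<^sup>T * L = (sel r n * Xi)\<^sup>T * (sel r n * Xi)"
proof -
  define E where "E = sel r n * Xi"
  define SA SL where "SA = Sigma_A m q1 q2 q3 c" and "SL = Sigma_L p q1 q2 q3 s"
  note d = carrier_matD[OF Xi(1)] carrier_matD[OF GSVD_dims(5)] carrier_matD[OF GSVD_dims(6)]
  have [simp]: "dim_row SA = m" "dim_col SA = r" "dim_row SL = p" "dim_col SL = r"
      "dim_row E = r" "dim_col E = n"
    using d by (auto simp: SA_def SL_def E_def GSVD_Sigma_A GSVD_Sigma_L)
  have [simp]: "PA\<^sup>T * (PA * Z) = Z" if "dim_row Z = m" for Z
    using GSVD_PA(1) that d by (metis index_transpose_mat(3) mat_mult_assoc one_mat_mult)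
  have [simp]: "PL\<^sup>T * (PL * Z) = Z" if "dim_row Z = p" for Z
    using GSVD_PL that d by (metis index_transpose_mat(3) mat_mult_assoc one_mat_mult)
  have "A\<^sup>T * A + L\<^sup>T * L = E\<^sup>T * ((SA\<^sup>T * SA + SL\<^sup>T * SL) * E)"
    unfolding Xi(2,3) SA_def[symmetric] SL_def[symmetric] E_def[symmetric]
    using d by (simp add: mat_mult_transpose mat_mult_assoc mat_mult_add mat_add_mult)
  then show ?thesis using GSVD_gram unfolding SA_def[symmetric] SL_def[symmetric] E_def[symmetric]
    by (simp add: one_mat_mult)
qed

text \<open>The first \<open>r\<close> columns of \<open>X\<close> provide the right inverse that
  \<open>pinv_gram\<close> asks for.\<close>

lemma GSVD_right_inverse:
  assumes Xi: "Xi \<in> carrier_mat n n" "Xi * X = 1\<^sub>m n"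
  shows "(sel r n * Xi) * (X * (sel r n)\<^sup>T) = 1\<^sub>m r"
proof -
  note d = carrier_matD[OF Xi(1)] carrier_matD[OF GSVD_dims(7)]
  have "(sel r n * Xi) * (X * (sel r n)\<^sup>T) = sel r n * ((Xi * X) * (sel r n)\<^sup>T)"
    by (simp add: mat_mult_assoc d)
  then show ?thesis using GSVD_dims(2) by (simp add: Xi one_mat_mult sel_mult_transpose)
qed

lemma GSVD_pinv: "is_pinv (A\<^sup>T * A + L\<^sup>T * L) (pinv (A\<^sup>T * A + L\<^sup>T * L))"
proof -
  obtain Xi where Xi: "Xi \<in> carrier_mat n n" "X * Xi = 1\<^sub>m n" "Xi * X = 1\<^sub>m n"
    "A = PA * (Sigma_A m q1 q2 q3 c * (sel r n * Xi))"
    "L = PL * (Sigma_L p q1 q2 q3 s * (sel r n * Xi))" by (rule GSVD_obtain)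
  show ?thesis unfolding GSVD_normal_matrix[OF Xi(1,4,5)]
    by (rule pinv_gram(1)[OF _ _ GSVD_right_inverse[OF Xi(1,3)]])
      (use Xi GSVD_dims in auto)
qed

text \<open>With M = E^T E and A = PA SA E, everything follows from E M^+ E^T = 1. The third claim
  puts the columns of \<open>A\<^sup>T\<close> into the range of \<open>M\<close>; it makes M^+ A^T
  the adjoint of \<open>A\<close> with respect to the form of \<open>M\<close>, even if
  \<open>M\<close> is singular.\<close>

lemma GSVD_pinv_absorb:
  "A\<^sup>T * A + L\<^sup>T * L \<in> carrier_mat n n" "pinv (A\<^sup>T * A + L\<^sup>T * L) \<in> carrier_mat n n"
  "(A\<^sup>T * A + L\<^sup>T * L) * pinv (A\<^sup>T * A + L\<^sup>T * L) * A\<^sup>T = A\<^sup>T"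
  "A * pinv (A\<^sup>T * A + L\<^sup>T * L) * A\<^sup>T =
     PA * mat_diag m (\<lambda>i. if i < q1 + q2 then (c (i + 1))\<^sup>2 else 0) * PA\<^sup>T"
proof -
  obtain Xi where Xi: "Xi \<in> carrier_mat n n" "X * Xi = 1\<^sub>m n" "Xi * X = 1\<^sub>m n"
    "A = PA * (Sigma_A m q1 q2 q3 c * (sel r n * Xi))"
    "L = PL * (Sigma_L p q1 q2 q3 s * (sel r n * Xi))" by (rule GSVD_obtain)
  define E where "E = sel r n * Xi"
  define SA where "SA = Sigma_A m q1 q2 q3 c"
  define M N where "M = A\<^sup>T * A + L\<^sup>T * L" and "N = pinv M"
  note d = carrier_matD[OF Xi(1)] carrier_matD[OF GSVD_dims(5)] carrier_matD[OF GSVD_dims(6)]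
  have [simp]: "dim_row SA = m" "dim_col SA = r" "dim_row E = r" "dim_col E = n"
    using d by (auto simp: SA_def E_def GSVD_Sigma_A)
  have ME: "M = E\<^sup>T * E" unfolding M_def E_def by (rule GSVD_normal_matrix[OF Xi(1,4,5)])
  have Ec: "E \<in> carrier_mat r n" by auto
  show M: "A\<^sup>T * A + L\<^sup>T * L \<in> carrier_mat n n" unfolding M_def[symmetric] ME using Ec by auto
  show N: "pinv (A\<^sup>T * A + L\<^sup>T * L) \<in> carrier_mat n n"
    using GSVD_pinv M by (auto simp: is_pinv_def)
  note N' = carrier_matD[OF N[folded M_def N_def]]
  have ENE: "E * (N * E\<^sup>T) = 1\<^sub>m r"
    using pinv_gram(2)[OF Ec _ GSVD_right_inverse[OF Xi(1,3), folded E_def]] N' Ec Xi GSVD_dims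
    by (simp add: N_def ME mat_mult_assoc)
  have AE: "A = PA * (SA * E)" using Xi by (simp add: SA_def E_def)
  have ENEZ: "E * (N * (E\<^sup>T * Z)) = Z" if "dim_row Z = r" for Z
  proof -
    have "E * (N * (E\<^sup>T * Z)) = (E * (N * E\<^sup>T)) * Z" using that N' by (simp add: mat_mult_assoc)
    then show ?thesis using that by (simp add: ENE one_mat_mult)
  qed
  show "(A\<^sup>T * A + L\<^sup>T * L) * pinv (A\<^sup>T * A + L\<^sup>T * L) * A\<^sup>T = A\<^sup>T"
    unfolding M_def[symmetric] N_def[symmetric]
    unfolding AE ME using N' d by (simp add: mat_mult_transpose mat_mult_assoc ENEZ)
  have "SA * SA\<^sup>T = mat_diag m (\<lambda>i. if i < q1 + q2 then (c (i + 1))\<^sup>2 else 0)"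
  proof (rule eq_matI, goal_cases)
    case (1 i j)
    then have ij: "i < m" "j < m" by (auto simp: mat_diag_def)
    have "(SA * SA\<^sup>T) $$ (i, j) = (\<Sum>k = 0..<r. SA $$ (i, k) * SA $$ (j, k))"
      using ij by (simp add: scalar_prod_def)
    also have "\<dots> = (\<Sum>k = 0..<r. if k = i then if i = j \<and> i < q1 + q2 then (c (i + 1))\<^sup>2 else 0 else 0)"
      by (rule sum.cong) (use ij in \<open>auto simp: SA_def GSVD_Sigma_A power2_eq_square\<close>)
    finally have "(SA * SA\<^sup>T) $$ (i, j) =
      (\<Sum>k = 0..<r. if k = i then if i = j \<and> i < q1 + q2 then (c (i + 1))\<^sup>2 else 0 else 0)" .
    then show ?case using ij GSVD_dims by (auto simp: mat_diag_def)
  qed (auto simp: mat_diag_def)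
  moreover have "A * N * A\<^sup>T = PA * ((SA * SA\<^sup>T) * PA\<^sup>T)"
    unfolding AE using N' d by (simp add: mat_mult_transpose mat_mult_assoc ENEZ)
  ultimately show "A * pinv (A\<^sup>T * A + L\<^sup>T * L) * A\<^sup>T =
     PA * mat_diag m (\<lambda>i. if i < q1 + q2 then (c (i + 1))\<^sup>2 else 0) * PA\<^sup>T"
    using d by (simp add: mat_mult_assoc M_def N_def mat_diag_def)
qed

end

section \<open>Reflecting a GSVD inside an eigenspace\<close>

text \<open>This is I - t g g^T. With \<open>g\<close> a function on nat, one coefficient family
  serves in the dimensions \<open>m\<close>, \<open>n\<close> and \<open>r\<close> without explicit
  truncation or zero padding.\<close>

definition reflection_mat :: "nat \<Rightarrow> real \<Rightarrow> (nat \<Rightarrow> real) \<Rightarrow> real mat" where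
  "reflection_mat d t g = mat d d (\<lambda>(i, j). (if i = j then 1 else 0) - t * g i * g j)"

lemma reflection_mat_dim [simp]:
  "dim_row (reflection_mat d t g) = d" "dim_col (reflection_mat d t g) = d"
  "reflection_mat d t g \<in> carrier_mat d d"
  by (auto simp: reflection_mat_def)

lemma reflection_mat_transpose: "(reflection_mat d t g)\<^sup>T = reflection_mat d t g"
  by (rule eq_matI) (auto simp: reflection_mat_def)

lemma sum_delta_mult:
  fixes f :: "nat \<Rightarrow> real"
  assumes "i < d"
  shows "(\<Sum>k = 0..<d. (if i = k then 1 else 0) * f k) = f i" "(\<Sum>k = 0..<d. f k * (if k = i then 1 else 0)) = f i"
proof -
  have "(\<Sum>k = 0..<d. (if i = k then 1 else 0) * f k) = (\<Sum>k = 0..<d. if k = i then f i else 0)"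
    by (rule sum.cong) auto
  then show "(\<Sum>k = 0..<d. (if i = k then 1 else 0) * f k) = f i" using assms by simp
  have "(\<Sum>k = 0..<d. f k * (if k = i then 1 else 0)) = (\<Sum>k = 0..<d. if k = i then f i else 0)"
    by (rule sum.cong) auto
  then show "(\<Sum>k = 0..<d. f k * (if k = i then 1 else 0)) = f i" using assms by simp
qed

lemma mult_reflection_mat:
  assumes "dim_col C = d" "i < dim_row C" "j < d"
  shows "(C * reflection_mat d t g) $$ (i, j) = C $$ (i, j) - t * (\<Sum>k = 0..<d. C $$ (i, k) * g k) * g j"
proof -
  have "(C * reflection_mat d t g) $$ (i, j) =
      (\<Sum>k = 0..<d. C $$ (i, k) * ((if k = j then 1 else 0) - t * g k * g j))"
    using assms by (simp add: scalar_prod_def reflection_mat_def)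
  also have "\<dots> = (\<Sum>k = 0..<d. C $$ (i, k) * (if k = j then 1 else 0)) - (\<Sum>k = 0..<d. C $$ (i, k) * (t * g k * g j))"
    by (simp add: right_diff_distrib sum_subtractf)
  also have "(\<Sum>k = 0..<d. C $$ (i, k) * (t * g k * g j)) = t * (\<Sum>k = 0..<d. C $$ (i, k) * g k) * g j"
    by (simp add: sum_distrib_left sum_distrib_right mult_ac)
  finally show ?thesis using sum_delta_mult(2)[OF assms(3)] by simp
qed

lemma reflection_mat_mult:
  assumes "dim_row C = d" "i < d" "j < dim_col C"
  shows "(reflection_mat d t g * C) $$ (i, j) = C $$ (i, j) - t * g i * (\<Sum>k = 0..<d. C $$ (k, j) * g k)"
proof -
  have "(reflection_mat d t g * C) $$ (i, j) =
      (C\<^sup>T * reflection_mat d t g) $$ (j, i)"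
    using assms reflection_mat_transpose[of d t g]
    by (metis index_mult_mat(2,3) index_transpose_mat(1) mat_mult_transpose reflection_mat_dim(1,2))
  also have "\<dots> = C\<^sup>T $$ (j, i) - t * (\<Sum>k = 0..<d. C\<^sup>T $$ (j, k) * g k) * g i"
    using assms by (subst mult_reflection_mat) auto
  also have "(\<Sum>k = 0..<d. C\<^sup>T $$ (j, k) * g k) = (\<Sum>k = 0..<d. C $$ (k, j) * g k)"
    using assms by (intro sum.cong) auto
  finally show ?thesis using assms by simp
qed

text \<open>The square is I + t (t |g|^2 - 2) g g^T. The second alternative covers g = 0, where t
  |g|^2 = 2 is impossible.\<close>

lemma reflection_mat_involution:
  assumes "t * (\<Sum>k = 0..<d. g k * g k) = 2 \<or> (\<forall>k<d. g k = 0)"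
  shows "reflection_mat d t g * reflection_mat d t g = 1\<^sub>m d"
proof (rule eq_matI, goal_cases)
  case (1 i j)
  then have ij: "i < d" "j < d" by auto
  define S where "S = (\<Sum>k = 0..<d. g k * g k)"
  have "(\<Sum>k = 0..<d. reflection_mat d t g $$ (i, k) * g k) =
      (\<Sum>k = 0..<d. (if i = k then 1 else 0) * g k - t * g i * (g k * g k))"
    using ij by (intro sum.cong) (auto simp: reflection_mat_def algebra_simps)
  also have "\<dots> = g i - t * g i * S"
    unfolding sum_subtractf sum_delta_mult[OF ij(1)] S_def by (simp add: sum_distrib_left)
  finally have "(reflection_mat d t g * reflection_mat d t g) $$ (i, j) =
      reflection_mat d t g $$ (i, j) - t * (g i - t * g i * S) * g j"
    using ij mult_reflection_mat[of "reflection_mat d t g" d i j t g] by simp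
  also have "\<dots> = (if i = j then 1 else 0) + t * (t * S - 2) * (g i * g j)"
    using ij by (simp add: reflection_mat_def algebra_simps)
  also have "t * (t * S - 2) * (g i * g j) = 0"
    using assms ij by (auto simp: S_def)
  finally show ?case using ij by simp
qed auto

text \<open>The hypotheses say C g2 = \<rho> g1 and C^T g1 = \<rho> g2, so both sides equal C - t
  \<rho> g1 g2^T.\<close>

lemma reflection_mat_intertwine:
  assumes C: "C \<in> carrier_mat d1 d2"
    and r: "\<And>i. i < d1 \<Longrightarrow> (\<Sum>k = 0..<d2. C $$ (i, k) * g2 k) = \<rho> * g1 i"
    and l: "\<And>j. j < d2 \<Longrightarrow> (\<Sum>k = 0..<d1. C $$ (k, j) * g1 k) = \<rho> * g2 j"
  shows "C * reflection_mat d2 t g2 = reflection_mat d1 t g1 * C"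
proof (rule eq_matI, goal_cases)
  case (1 i j)
  then have ij: "i < d1" "j < d2" using C by auto
  show ?case
    using C ij by (simp add: mult_reflection_mat reflection_mat_mult r l del: index_mult_mat)
qed (use C in auto)

lemma sum_single_index:
  fixes f :: "nat \<Rightarrow> real"
  assumes "\<And>k. k < d \<Longrightarrow> k \<noteq> a \<Longrightarrow> f k = 0" "a < d"
  shows "(\<Sum>k = 0..<d. f k) = f a"
proof -
  have "(\<Sum>k = 0..<d. f k) = (\<Sum>k = 0..<d. if k = a then f a else 0)"
    by (rule sum.cong) (use assms in auto)
  then show ?thesis using assms(2) by simp
qed

lemma orthonormal_mult_reflection:
  assumes "P \<in> carrier_mat d d" "P\<^sup>T * P = 1\<^sub>m d"
    "reflection_mat d t g * reflection_mat d t g = 1\<^sub>m d"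
  shows "orthonormal_cols (P * reflection_mat d t g)"
proof -
  have "(P * reflection_mat d t g)\<^sup>T * (P * reflection_mat d t g) =
      reflection_mat d t g * ((P\<^sup>T * P) * reflection_mat d t g)"
    using carrier_matD[OF assms(1)] by (simp add: mat_mult_transpose mat_mult_assoc reflection_mat_transpose)
  then show ?thesis using assms by (simp add: orthonormal_cols_def one_mat_mult)
qed

text \<open>On the support of \<open>h\<close> the diagonal blocks are constant, so they intertwine
  the reflections on their two sides. Inserting \<open>Rn * Rn = 1\<close> in front of
  \<open>Xi\<close> and moving one factor leftwards through the blocks attaches it to
  \<open>PA\<close> and, shifted, to \<open>PL\<close>; the other stays with the inverse of
  \<open>X\<close>.\<close>

lemma GSVD_reflect:
  assumes gsvd: "is_GSVD m p n r A L q1 q2 q3 c s PA PL X"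
    and supp: "\<And>i. h i \<noteq> 0 \<Longrightarrow> i < q1 + q2 \<and> c (i + 1) = \<sigma>"
    and t: "t * (\<Sum>k = 0..<m. h k * h k) = 2 \<or> (\<forall>k<m. h k = 0)"
  shows "\<exists>PL' X'. is_GSVD m p n r A L q1 q2 q3 c s (PA * reflection_mat m t h) PL' X'"
proof -
  note gd = GSVD_dims[OF gsvd]
  obtain Xi where Xi: "Xi \<in> carrier_mat n n" "X * Xi = 1\<^sub>m n" "Xi * X = 1\<^sub>m n"
    "A = PA * (Sigma_A m q1 q2 q3 c * (sel r n * Xi))"
    "L = PL * (Sigma_L p q1 q2 q3 s * (sel r n * Xi))" by (rule GSVD_obtain[OF gsvd])
  \<comment> \<open>\<open>Sigma_L\<close> carries index \<open>j\<close> to row \<open>j + p - r\<close>. If \<open>\<sigma> = 1\<close> then \<open>h\<close> lives on the first \<open>q1\<close> indices,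
    where \<open>L\<close> vanishes, and \<open>hL = 0\<close>.\<close>
  define hL where "hL i = (if p + q1 \<le> i + r then h (i + r - p) else 0)" for i
  define SA SL where "SA = Sigma_A m q1 q2 q3 c" and "SL = Sigma_L p q1 q2 q3 s"
  have SA: "SA = mat m r (\<lambda>(i, j). if i = j \<and> j < q1 + q2 then c (j + 1) else 0)"
    unfolding SA_def by (rule GSVD_Sigma_A[OF gsvd])
  have SL: "SL = mat p r (\<lambda>(i, j). if i + r = j + p \<and> q1 \<le> j then s (j + 1) else 0)"
    unfolding SL_def by (rule GSVD_Sigma_L[OF gsvd])
  define Rm Rp Rn Rr where "Rm = reflection_mat m t h" and "Rp = reflection_mat p t hL"
    and "Rn = reflection_mat n t h" and "Rr = reflection_mat r t h"
  note Rdefs = Rm_def Rp_def Rn_def Rr_def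
  have h0: "h i = 0" if "q1 + q2 \<le> i" for i using supp[of i] that by auto
  have s\<sigma>: "s (i + 1) = sqrt (1 - \<sigma>\<^sup>2)" if "h i \<noteq> 0" for i
    using GSVD_s_eq[OF gsvd, of "i + 1"] supp[OF that] gd by auto
  \<comment> \<open>\<open>h\<close> vanishes from q1 + q2 on, so its squared norm is the same in
    the dimensions \<open>m\<close>, \<open>n\<close> and \<open>r\<close>, and the same
    \<open>t\<close> gives an involution in each.\<close>
  have sumh: "(\<Sum>k = 0..<d. h k * h k) = (\<Sum>k = 0..<q1 + q2. h k * h k)" if "q1 + q2 \<le> d" for d
    by (rule sum.mono_neutral_right) (use that h0 in auto)
  have q1: "\<sigma> = 1" if "h i \<noteq> 0" "i < q1" for i
    using supp[OF that(1)] gsvd that(2) by (auto simp: is_GSVD_def)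
  have q1': "i < q1" if "h i \<noteq> 0" "\<sigma> = 1" for i
  proof (rule ccontr)
    assume "\<not> i < q1"
    then have "c (i + 1) < 1" using supp[OF that(1)] gsvd by (auto simp: is_GSVD_def)
    then show False using supp[OF that(1)] that(2) by auto
  qed
  have selR: "sel r n * Rn = Rr * sel r n"
    unfolding Rdefs
  proof (rule reflection_mat_intertwine[where \<rho> = 1])
    fix i assume "i < r"
    then show "(\<Sum>k = 0..<n. sel r n $$ (i, k) * h k) = 1 * h i"
      using gd by (subst sum_single_index[of _ i]) (auto simp: sel_def)
  next
    fix j assume j: "j < n"
    show "(\<Sum>k = 0..<r. sel r n $$ (k, j) * h k) = 1 * h j"
    proof (cases "j < r")
      case True
      then show ?thesis using j by (subst sum_single_index[of _ j]) (auto simp: sel_def)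
    next
      case False
      then show ?thesis using h0[of j] j gd by (auto simp: sel_def intro!: sum.neutral)
    qed
  qed simp
  have SAR: "SA * Rr = Rm * SA"
    unfolding Rdefs
  proof (rule reflection_mat_intertwine[where \<rho> = \<sigma>])
    fix i assume i: "i < m"
    show "(\<Sum>k = 0..<r. SA $$ (i, k) * h k) = \<sigma> * h i"
    proof (cases "i < r")
      case True
      then show ?thesis using i supp[of i] by (subst sum_single_index[of _ i]) (auto simp: SA)
    next
      case False
      then show ?thesis using h0[of i] i gd by (auto simp: SA intro!: sum.neutral)
    qed
  next
    fix j assume j: "j < r"
    show "(\<Sum>k = 0..<m. SA $$ (k, j) * h k) = \<sigma> * h j"
    proof (cases "j < m")
      case True
      then show ?thesis using j supp[of j] by (subst sum_single_index[of _ j]) (auto simp: SA)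
    next
      case False
      then show ?thesis using h0[of j] j gd by (auto simp: SA intro!: sum.neutral)
    qed
  qed (auto simp: SA)
  have SLR: "SL * Rr = Rp * SL"
    unfolding Rdefs
  proof (rule reflection_mat_intertwine[where \<rho> = "sqrt (1 - \<sigma>\<^sup>2)"])
    fix i assume i: "i < p"
    show "(\<Sum>k = 0..<r. SL $$ (i, k) * h k) = sqrt (1 - \<sigma>\<^sup>2) * hL i"
    proof (cases "p + q1 \<le> i + r")
      case True
      then show ?thesis using i s\<sigma>[of "i + r - p"]
        by (subst sum_single_index[of _ "i + r - p"]) (auto simp: SL hL_def)
    next
      case False
      then show ?thesis using i by (auto simp: SL hL_def intro!: sum.neutral)
    qed
  next
    fix j assume j: "j < r"
    show "(\<Sum>k = 0..<p. SL $$ (k, j) * hL k) = sqrt (1 - \<sigma>\<^sup>2) * h j"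
    proof (cases "q1 \<le> j")
      case True
      then have "j + p - r + r - p = j" "j + p - r + r = j + p" "j + p - r < p" using j gd by auto
      then show ?thesis using j True s\<sigma>[of j]
        by (subst sum_single_index[of _ "j + p - r"]) (auto simp: SL hL_def)
    next
      case False
      then show ?thesis using j q1[of j] by (auto simp: SL intro!: sum.neutral)
    qed
  qed (auto simp: SL)
  have hz: "\<forall>k. h k = 0" if "\<forall>k<m. h k = 0"
    using that h0 gd by (meson less_le_trans not_le)
  have RR: "Rm * Rm = 1\<^sub>m m" "Rn * Rn = 1\<^sub>m n"
    unfolding Rdefs using t sumh[of m] sumh[of n] gd hz by (auto intro!: reflection_mat_involution)
  have RRp: "Rp * Rp = 1\<^sub>m p"
    unfolding Rdefs
  proof (rule reflection_mat_involution)
    show "t * (\<Sum>k = 0..<p. hL k * hL k) = 2 \<or> (\<forall>k<p. hL k = 0)"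
    proof (cases "\<sigma> = 1 \<or> (\<forall>k<m. h k = 0)")
      case True
      have "hL k = 0" if "k < p" for k
      proof (cases "\<forall>k<m. h k = 0")
        case True
        then show ?thesis using hz by (auto simp: hL_def)
      next
        case False
        have "\<not> k + r - p < q1" if "p + q1 \<le> k + r" using that by linarith
        then show ?thesis using False True q1'[of "k + r - p"] by (auto simp: hL_def)
      qed
      then show ?thesis by simp
    next
      case False
      \<comment> \<open>For \<sigma> different from 1 nothing of \<open>h\<close> sits below
        \<open>q1\<close>, so the shift by p - r loses no entry and \<open>hL\<close> has the norm
        of \<open>h\<close>.\<close>
      have "(\<Sum>k = 0..<p. hL k * hL k) = (\<Sum>k = p + q1 - r..<p. h (k + r - p) * h (k + r - p))"
        by (rule sum.mono_neutral_cong_right) (auto simp: hL_def)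
      also have "\<dots> = (\<Sum>j = q1..<r. h j * h j)"
        by (rule sum.reindex_bij_witness[of _ "\<lambda>j. j + p - r" "\<lambda>k. k + r - p"]) (use gd in auto)
      also have "\<dots> = (\<Sum>j = 0..<r. h j * h j)"
      proof (rule sum.mono_neutral_left)
        show "\<forall>i\<in>{0..<r} - {q1..<r}. h i * h i = 0" using q1 False by (metis DiffD1 DiffD2 atLeastLessThan_iff mult_zero_left not_le)
      qed auto
      finally show ?thesis using t False sumh[of m] sumh[of r] gd by auto
    qed
  qed
  define C D where "C = pad_zero_cols (n - r) SA" and "D = pad_zero_cols (n - r) SL"
  have C: "C = SA * sel r n" unfolding C_def
    using gd by (subst pad_zero_cols_sel[of _ m r]) (auto simp: SA)
  have D: "D = SL * sel r n" unfolding D_def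
    using gd by (subst pad_zero_cols_sel[of _ p r]) (auto simp: SL)
  note d = carrier_matD[OF Xi(1)] carrier_matD[OF gd(5)] carrier_matD[OF gd(6)] carrier_matD[OF gd(7)]
  have [simp]: "dim_row SA = m" "dim_col SA = r" "dim_row SL = p" "dim_col SL = r"
    "dim_row Rm = m" "dim_col Rm = m" "dim_row Rn = n" "dim_col Rn = n"
    "dim_row Rp = p" "dim_col Rp = p" "dim_row Rr = r" "dim_col Rr = r"
    "dim_row C = m" "dim_col C = n" "dim_row D = p" "dim_col D = n"
    by (auto simp: SA SL Rdefs C D)
  have CR: "C * Rn = Rm * C"
  proof -
    have "C * Rn = SA * (sel r n * Rn)" by (simp add: C mat_mult_assoc)
    also have "\<dots> = (SA * Rr) * sel r n" by (simp add: selR mat_mult_assoc)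
    finally show ?thesis by (simp add: SAR C mat_mult_assoc)
  qed
  have DR: "D * Rn = Rp * D"
  proof -
    have "D * Rn = SL * (sel r n * Rn)" by (simp add: D mat_mult_assoc)
    also have "\<dots> = (SL * Rr) * sel r n" by (simp add: selR mat_mult_assoc)
    finally show ?thesis by (simp add: SLR D mat_mult_assoc)
  qed
  have RnZ: "Rn * (Rn * Z) = Z" if "dim_row Z = n" for Z
    using RR(2) that by (simp add: one_mat_mult flip: mat_mult_assoc)
  have XiZ: "Xi * (X * Z) = Z" "X * (Xi * Z) = Z" if "dim_row Z = n" for Z
    using Xi(2,3) that d by (simp_all add: one_mat_mult flip: mat_mult_assoc)
  have eqA: "A = PA * Rm * C * (Rn * Xi)"
  proof -
    have "PA * Rm * C * (Rn * Xi) = PA * ((Rm * C) * (Rn * Xi))" using d by (simp add: mat_mult_assoc)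
    also have "\<dots> = PA * (C * (Rn * (Rn * Xi)))" unfolding CR[symmetric] using d by (simp add: mat_mult_assoc)
    also have "\<dots> = PA * (SA * (sel r n * Xi))" using d by (simp add: RnZ C mat_mult_assoc)
    finally show ?thesis using Xi by (simp add: SA_def)
  qed
  have eqL: "L = PL * Rp * D * (Rn * Xi)"
  proof -
    have "PL * Rp * D * (Rn * Xi) = PL * ((Rp * D) * (Rn * Xi))" using d by (simp add: mat_mult_assoc)
    also have "\<dots> = PL * (D * (Rn * (Rn * Xi)))" unfolding DR[symmetric] using d by (simp add: mat_mult_assoc)
    also have "\<dots> = PL * (SL * (sel r n * Xi))" using d by (simp add: RnZ D mat_mult_assoc)
    finally show ?thesis using Xi by (simp add: SL_def)
  qed
  have "\<exists>Xi'\<in>carrier_mat n n. inverts_mat (X * Rn) Xi' \<and> inverts_mat Xi' (X * Rn) \<and>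
        A = PA * Rm * C * Xi' \<and> L = PL * Rp * D * Xi'"
  proof (intro bexI conjI)
    show "Rn * Xi \<in> carrier_mat n n" using d by (auto intro: carrier_matI)
    show "inverts_mat (X * Rn) (Rn * Xi)" "inverts_mat (Rn * Xi) (X * Rn)"
      using d by (simp_all add: inverts_mat_def mat_mult_assoc RnZ XiZ RR Xi)
  qed (fact eqA eqL)+
  moreover have "orthonormal_cols (PA * Rm)" "orthonormal_cols (PL * Rp)"
    using orthonormal_mult_reflection[OF gd(5) GSVD_PA(1)[OF gsvd]]
      orthonormal_mult_reflection[OF gd(6) GSVD_PL[OF gsvd]] RR RRp by (auto simp: Rdefs)
  moreover have "PA * Rm \<in> carrier_mat m m" "PL * Rp \<in> carrier_mat p p" "X * Rn \<in> carrier_mat n n"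
    using d by (auto intro: carrier_matI)
  ultimately have "is_GSVD m p n r A L q1 q2 q3 c s (PA * Rm) (PL * Rp) (X * Rn)"
    using gsvd unfolding is_GSVD_def SA_def SL_def C_def D_def by blast
  then show ?thesis unfolding Rm_def by blast
qed

text \<open>The coordinates \<open>a\<close> of \<open>w\<close> in the basis \<open>PA\<close> and
  the unit vector e_l have the same length, so the reflection along a - e_l exchanges them and
  column \<open>l\<close> becomes \<open>w\<close>. Choosing \<open>l\<close> with a_l nonzero keeps
  a - e_l supported where \<open>c\<close> has the value \<sigma>, so the columns for other values
  stay fixed.\<close>

lemma GSVD_extend:
  assumes gsvd: "is_GSVD m p n r A L q1 q2 q3 c s PA PL X"
    and w: "w \<in> carrier_vec m" "w \<bullet> w = 1"
    and supp: "\<And>i. i < m \<Longrightarrow> (PA\<^sup>T *\<^sub>v w) $ i \<noteq> 0 \<Longrightarrow> i < q1 + q2 \<and> c (i + 1) = \<sigma>"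
  shows "\<exists>PA' PL' X' l. is_GSVD m p n r A L q1 q2 q3 c s PA' PL' X' \<and>
    l < q1 + q2 \<and> c (l + 1) = \<sigma> \<and> col PA' l = w \<and>
    (\<forall>i<m. c (i + 1) \<noteq> \<sigma> \<longrightarrow> col PA' i = col PA i)"
proof -
  note gd = GSVD_dims[OF gsvd]
  note d = carrier_matD[OF gd(5)] carrier_vecD[OF w(1)]
  define a where "a = PA\<^sup>T *\<^sub>v w"
  have a: "dim_vec a = m" using d by (simp add: a_def)
  have "PA *\<^sub>v a = (PA * PA\<^sup>T) *\<^sub>v w" unfolding a_def using d by (simp add: mat_vec_assoc)
  then have PAa: "PA *\<^sub>v a = w" using w GSVD_PA[OF gsvd] by simp
  have "a \<bullet> a = 1" using PAa w d by (simp add: a_def mat_vec_adjoint)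
  then have aa: "(\<Sum>k = 0..<m. a $ k * a $ k) = 1" using a by (simp add: scalar_prod_def)
  then obtain l where l: "l < m" "a $ l \<noteq> 0"
    by (metis (no_types, lifting) atLeastLessThan_iff mult_eq_0_iff sum.neutral zero_neq_one)
  have lc: "l < q1 + q2" "c (l + 1) = \<sigma>" using supp[OF l(1)] l(2) by (auto simp: a_def)
  define h where "h i = (if i < m then a $ i - (if i = l then 1 else 0) else 0)" for i
  define S where "S = (\<Sum>k = 0..<m. h k * h k)"
  \<comment> \<open>If \<open>w\<close> already is column \<open>l\<close>, then
    \<open>S = 0\<close>, division by zero gives \<open>t = 0\<close>, and the reflection is the
    identity.\<close>
  define t where "t = 2 / S"
  \<comment> \<open>|a - e_l|^2 = 2 - 2 a_l for unit vectors. Unless \<open>S = 0\<close>, it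
    follows that t h_l = -1, which is exactly the factor that turns column \<open>l\<close> into
    \<open>w\<close>.\<close>
  have S: "S = - 2 * h l"
  proof -
    have "S = (\<Sum>k = 0..<m. a $ k * a $ k + (1 - 2 * a $ k) * (if k = l then 1 else 0))"
      unfolding S_def by (rule sum.cong) (auto simp: h_def algebra_simps)
    also have "\<dots> = 1 + (1 - 2 * a $ l)"
      unfolding sum.distrib aa by (subst sum_delta_mult(2)[OF l(1)]) simp
    finally show ?thesis using l by (simp add: h_def)
  qed
  have h0: "h k = 0" if "S = 0" "k < m" for k
  proof -
    have "\<forall>k\<in>{0..<m}. h k * h k = 0"
      using that(1) unfolding S_def by (subst (asm) sum_nonneg_eq_0_iff) auto
    then show ?thesis using that(2) by auto
  qed
  have "\<exists>PL' X'. is_GSVD m p n r A L q1 q2 q3 c s (PA * reflection_mat m t h) PL' X'"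
  proof (rule GSVD_reflect[OF gsvd, of _ \<sigma>])
    fix i assume "h i \<noteq> 0"
    then show "i < q1 + q2 \<and> c (i + 1) = \<sigma>"
      using supp[of i] lc by (cases "i = l") (auto simp: h_def a_def split: if_splits)
  next
    show "t * (\<Sum>k = 0..<m. h k * h k) = 2 \<or> (\<forall>k<m. h k = 0)"
      using h0 by (cases "S = 0") (auto simp: t_def S_def[symmetric])
  qed
  then obtain PL' X' where new: "is_GSVD m p n r A L q1 q2 q3 c s (PA * reflection_mat m t h) PL' X'"
    by blast
  have "col (PA * reflection_mat m t h) l = w"
  proof (rule eq_vecI)
    fix i assume "i < dim_vec w"
    then have i: "i < m" using d by simp
    have "(\<Sum>k = 0..<m. PA $$ (i, k) * h k) =
        (\<Sum>k = 0..<m. PA $$ (i, k) * a $ k - PA $$ (i, k) * (if k = l then 1 else 0))"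
      by (rule sum.cong) (auto simp: h_def algebra_simps)
    also have "\<dots> = (PA *\<^sub>v a) $ i - PA $$ (i, l)"
      unfolding sum_subtractf sum_delta_mult(2)[OF l(1)] using d i a by (simp add: scalar_prod_def)
    finally have e: "(\<Sum>k = 0..<m. PA $$ (i, k) * h k) = w $ i - PA $$ (i, l)" unfolding PAa .
    have "(PA * reflection_mat m t h) $$ (i, l) = PA $$ (i, l) - t * (w $ i - PA $$ (i, l)) * h l"
      using d i l e by (subst mult_reflection_mat) auto
    also have "\<dots> = w $ i"
    proof (cases "S = 0")
      case True
      then have "w $ i - PA $$ (i, l) = 0" using e h0 by simp
      then show ?thesis by simp
    next
      case False
      then have "h l \<noteq> 0" using S by auto
      then show ?thesis by (simp add: t_def S)
    qed
    finally show "col (PA * reflection_mat m t h) l $ i = w $ i" using i l d by simp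
  qed (use d in simp)
  moreover have "col (PA * reflection_mat m t h) j = col PA j" if j: "j < m" "c (j + 1) \<noteq> \<sigma>" for j
  proof (rule eq_vecI)
    fix i assume "i < dim_vec (col PA j)"
    then have i: "i < m" using d by simp
    have "h j = 0" using j lc supp[of j] by (cases "j = l") (auto simp: h_def a_def)
    then have "(PA * reflection_mat m t h) $$ (i, j) = PA $$ (i, j)"
      using d i j by (subst mult_reflection_mat) auto
    then show "col (PA * reflection_mat m t h) j $ i = col PA j $ i" using i j d by simp
  qed (use d in simp)
  ultimately show ?thesis using new lc by blast
qed

lemma col_mult:
  "dim_col A = dim_row B \<Longrightarrow> i < dim_col B \<Longrightarrow> col (A * B) i = A *\<^sub>v col (B :: real mat) i"
  by (rule eq_vecI) auto

lemma col_mult_sel_transpose: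
  assumes "i < r" "r \<le> n" "dim_col Z = n"
  shows "col (Z * (sel r n)\<^sup>T) i = col Z i"
proof (rule eq_vecI)
  fix k assume k: "k < dim_vec (col Z i)"
  have "(Z * (sel r n)\<^sup>T) $$ (k, i) = (\<Sum>j = 0..<n. Z $$ (k, j) * sel r n $$ (i, j))"
    using assms k by (simp add: scalar_prod_def)
  also have "\<dots> = Z $$ (k, i)"
    using assms by (subst sum_single_index[of _ i]) (auto simp: sel_def)
  finally show "col (Z * (sel r n)\<^sup>T) i $ k = col Z i $ k" using assms k by simp
qed simp

section \<open>Moving the first r columns of X into the range of M\<close>

text \<open>Both factorizations see the inverse of \<open>X\<close> only through its first
  \<open>r\<close> rows \<open>E\<close>. These survive when x_i is replaced by P x_i, where P = M^+
  M is the orthogonal projection onto the range of \<open>M\<close>, because E P = E.\<close>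

lemma GSVD_project:
  assumes gsvd: "is_GSVD m p n r A L q1 q2 q3 c s PA PL X"
    and M: "M = A\<^sup>T * A + L\<^sup>T * L"
  shows "\<exists>X'. is_GSVD m p n r A L q1 q2 q3 c s PA PL X' \<and>
    (\<forall>i<r. col X' i \<in> vec_space.col_space n M) \<and>
    (\<forall>i<q1 + q2. pinv M *\<^sub>v (A\<^sup>T *\<^sub>v col PA i) = c (i + 1) \<cdot>\<^sub>v col X' i)"
proof -
  note gd = GSVD_dims[OF gsvd]
  obtain Xi where Xi: "Xi \<in> carrier_mat n n" "X * Xi = 1\<^sub>m n" "Xi * X = 1\<^sub>m n"
    "A = PA * (Sigma_A m q1 q2 q3 c * (sel r n * Xi))"
    "L = PL * (Sigma_L p q1 q2 q3 s * (sel r n * Xi))" by (rule GSVD_obtain[OF gsvd])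
  define J where "J = sel r n"
  define E where "E = J * Xi"
  define SA SL where "SA = Sigma_A m q1 q2 q3 c" and "SL = Sigma_L p q1 q2 q3 s"
  define N where "N = pinv M"
  note Mc = GSVD_pinv_absorb(1)[OF gsvd, folded M] and Nc = GSVD_pinv_absorb(2)[OF gsvd, folded M N_def]
  note d = carrier_matD[OF Xi(1)] carrier_matD[OF gd(5)] carrier_matD[OF gd(6)] carrier_matD[OF gd(7)]
    carrier_matD[OF Mc] carrier_matD[OF Nc]
  have [simp]: "dim_row SA = m" "dim_col SA = r" "dim_row SL = p" "dim_col SL = r"
    "dim_row E = r" "dim_col E = n" "dim_row J = r" "dim_col J = n"
    using d by (auto simp: SA_def SL_def GSVD_Sigma_A[OF gsvd] GSVD_Sigma_L[OF gsvd] E_def J_def)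
  have Ec: "E \<in> carrier_mat r n" by auto
  have ME: "M = E\<^sup>T * E" unfolding M E_def J_def by (rule GSVD_normal_matrix[OF gsvd Xi(1,4,5)])
  have XJc: "X * J\<^sup>T \<in> carrier_mat n r" using d by (auto intro: carrier_matI)
  have ENE: "E * (N * E\<^sup>T) = 1\<^sub>m r"
    using pinv_gram(2)[OF Ec XJc GSVD_right_inverse[OF gsvd Xi(1,3), folded J_def E_def]] d
    by (simp add: N_def ME mat_mult_assoc)
  have ENEZ: "E * (N * (E\<^sup>T * Z)) = Z" if "dim_row Z = r" for Z
  proof -
    have "E * (N * (E\<^sup>T * Z)) = (E * (N * E\<^sup>T)) * Z" using that d by (simp add: mat_mult_assoc)
    then show ?thesis using that by (simp add: ENE one_mat_mult)
  qed
  have XiZ: "Xi * (X * Z) = Z" "X * (Xi * Z) = Z" if "dim_row Z = n" for Z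
    using Xi(2,3) that d by (simp_all add: one_mat_mult flip: mat_mult_assoc)
  have EX: "E * X = J" using d Xi(3) by (simp add: E_def mat_mult_assoc mat_mult_one)
  \<comment> \<open>\<open>X' = X * (1 + Q)\<close> replaces the first \<open>r\<close> columns \<open>x\<close> of \<open>X\<close> by \<open>P x\<close>. Since \<open>P x - x\<close> lies in the kernel
    of \<open>E\<close>, spanned by the other columns, \<open>Q\<close> has square zero and \<open>1 - Q\<close> inverts \<open>1 + Q\<close>.\<close>
  define P where "P = N * M"
  define W where "W = Xi * (P * X) - 1\<^sub>m n"
  define Q where "Q = W * (J\<^sup>T * J)"
  have [simp]: "dim_row P = n" "dim_col P = n" "dim_row W = n" "dim_col W = n" "dim_row Q = n" "dim_col Q = n"
    using d by (auto simp: P_def W_def Q_def)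
  have JW: "J * W = 0\<^sub>m r n"
  proof -
    have "J * W = E * (P * X) - J" using d by (simp add: W_def mat_mult_minus E_def mat_mult_assoc mat_mult_one)
    also have "E * (P * X) = E * X" using d by (simp add: P_def ME mat_mult_assoc ENEZ)
    finally show ?thesis unfolding EX by auto
  qed
  have JQ: "J * Q = 0\<^sub>m r n"
  proof -
    have "J * Q = (J * W) * (J\<^sup>T * J)" by (simp add: Q_def mat_mult_assoc)
    then show ?thesis by (simp add: JW)
  qed
  have QQ: "Q * Q = 0\<^sub>m n n"
  proof -
    have "Q * Q = W * (J\<^sup>T * (J * Q))" by (simp add: Q_def mat_mult_assoc)
    then show ?thesis by (simp add: JQ)
  qed
  define X' Xi' where "X' = X * (1\<^sub>m n + Q)" and "Xi' = (1\<^sub>m n - Q) * Xi"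
  have X'c: "X' \<in> carrier_mat n n" and Xi'c: "Xi' \<in> carrier_mat n n"
    using d by (auto simp: X'_def Xi'_def intro: carrier_matI)
  have inv: "X' * Xi' = 1\<^sub>m n"
  proof -
    have "(1\<^sub>m n + Q) * (1\<^sub>m n - Q) = 1\<^sub>m n"
      by (rule eq_matI) (auto simp: mat_mult_minus mat_add_mult one_mat_mult mat_mult_one QQ)
    then have "(1\<^sub>m n + Q) * ((1\<^sub>m n - Q) * Xi) = Xi"
      using d by (simp add: one_mat_mult flip: mat_mult_assoc)
    then show ?thesis using d Xi by (simp add: X'_def Xi'_def mat_mult_assoc)
  qed
  have JXi': "J * Xi' = E"
  proof -
    have "J * Xi' = E - (J * Q) * Xi"
      using d by (simp add: Xi'_def mat_minus_mult mat_mult_minus one_mat_mult E_def mat_mult_assoc)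
    then show ?thesis unfolding JQ using d by auto
  qed
  have padA: "pad_zero_cols (n - r) SA = SA * J" unfolding J_def
    using gd by (subst pad_zero_cols_sel[of _ m r]) (auto intro: carrier_matI)
  have padL: "pad_zero_cols (n - r) SL = SL * J" unfolding J_def
    using gd by (subst pad_zero_cols_sel[of _ p r]) (auto intro: carrier_matI)
  have "\<exists>Xi'\<in>carrier_mat n n. inverts_mat X' Xi' \<and> inverts_mat Xi' X' \<and>
        A = PA * pad_zero_cols (n - r) SA * Xi' \<and> L = PL * pad_zero_cols (n - r) SL * Xi'"
  proof (intro bexI conjI)
    show "inverts_mat X' Xi'" "inverts_mat Xi' X'"
      using inv mat_mult_left_right_inverse[OF X'c Xi'c inv] X'c Xi'c by (auto simp: inverts_mat_def)
    show "A = PA * pad_zero_cols (n - r) SA * Xi'" "L = PL * pad_zero_cols (n - r) SL * Xi'"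
      using Xi(4,5) d carrier_matD[OF Xi'c]
      by (simp_all add: padA padL mat_mult_assoc JXi' flip: SA_def SL_def J_def E_def)
  qed (fact Xi'c)
  then have G': "is_GSVD m p n r A L q1 q2 q3 c s PA PL X'"
    using gsvd X'c unfolding is_GSVD_def SA_def SL_def by blast
  have JJ: "J * J\<^sup>T = 1\<^sub>m r" unfolding J_def by (rule sel_mult_transpose) (rule gd)
  have "X' * J\<^sup>T = P * (X * J\<^sup>T)"
  proof -
    have QJ: "Q * J\<^sup>T = W * J\<^sup>T" using JJ by (simp add: Q_def mat_mult_assoc mat_mult_one)
    have "X' * J\<^sup>T = X * J\<^sup>T + X * (W * J\<^sup>T)"
      using d by (simp add: X'_def mat_mult_assoc mat_add_mult mat_mult_add one_mat_mult QJ)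
    also have "X * (W * J\<^sup>T) = P * (X * J\<^sup>T) - X * J\<^sup>T"
      using d by (simp add: W_def mat_minus_mult mat_mult_minus one_mat_mult mat_mult_assoc XiZ)
    also have "X * J\<^sup>T + (P * (X * J\<^sup>T) - X * J\<^sup>T) = P * (X * J\<^sup>T)"
      using d by (intro eq_matI) auto
    finally show ?thesis .
  qed
  then have "col (X' * J\<^sup>T) i = col ((P * X) * J\<^sup>T) i" for i using d by (simp add: mat_mult_assoc)
  then have colX': "col X' i = P *\<^sub>v col X i" if "i < r" for i
    using that gd carrier_matD[OF X'c] d col_mult_sel_transpose[of i r n X']
      col_mult_sel_transpose[of i r n "P * X"] by (simp add: J_def col_mult)
  \<comment> \<open>Symmetry of \<open>N * M\<close> moves \<open>M\<close> to the left, which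
    exhibits the range of \<open>P\<close> inside that of \<open>M\<close>.\<close>
  have PM: "P = M * N\<^sup>T"
  proof -
    have "P = P\<^sup>T" using GSVD_pinv[OF gsvd] by (simp add: P_def N_def M is_pinv_def)
    also have "\<dots> = M\<^sup>T * N\<^sup>T" using d by (simp add: P_def mat_mult_transpose)
    also have "M\<^sup>T = M" by (simp add: ME mat_mult_transpose)
    finally show ?thesis .
  qed
  have "col X' i \<in> vec_space.col_space n M" if i: "i < r" for i
  proof -
    have "col X' i = M *\<^sub>v (N\<^sup>T *\<^sub>v col X i)" using colX'[OF i] d by (simp add: PM mat_vec_assoc)
    moreover have "N\<^sup>T *\<^sub>v col X i \<in> carrier_vec n" using d by (auto intro: carrier_vecI)
    ultimately show ?thesis using Mc by (subst vec_space.col_space_eq[OF Mc]) (auto intro: carrier_vecI)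
  qed
  moreover have "pinv M *\<^sub>v (A\<^sup>T *\<^sub>v col PA i) = c (i + 1) \<cdot>\<^sub>v col X' i" if i: "i < q1 + q2" for i
  proof -
    have ir: "i < r" "i < m" "i < n" using i gd by auto
    \<comment> \<open>Column by column, this and \<open>M * X = E\<^sup>T * J\<close> give A^T p_i =
      c_i M x_i; applying \<open>N\<close> then turns M x_i into P x_i, the new column.\<close>
    have "A\<^sup>T * PA = E\<^sup>T * (SA\<^sup>T * (PA\<^sup>T * PA))"
      using Xi(4) d by (simp add: mat_mult_transpose mat_mult_assoc flip: SA_def J_def E_def)
    then have AP: "A\<^sup>T * PA = E\<^sup>T * SA\<^sup>T" using GSVD_PA[OF gsvd] by (simp add: mat_mult_one)
    have MX: "M * X = E\<^sup>T * J" using d by (simp add: ME mat_mult_assoc EX)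
    have Ar: "dim_row A = m" "dim_col A = n" using Xi(4) d by (auto simp flip: SA_def J_def E_def)
    have "A\<^sup>T *\<^sub>v col PA i = E\<^sup>T *\<^sub>v col (SA\<^sup>T) i"
      using ir d Ar by (simp add: AP flip: col_mult del: col_transpose)
    also have "col (SA\<^sup>T) i = c (i + 1) \<cdot>\<^sub>v col J i"
      using ir i by (intro eq_vecI) (auto simp: SA_def GSVD_Sigma_A[OF gsvd] J_def sel_def)
    also have "E\<^sup>T *\<^sub>v (c (i + 1) \<cdot>\<^sub>v col J i) = c (i + 1) \<cdot>\<^sub>v (E\<^sup>T *\<^sub>v col J i)"
      by (rule mult_mat_vec[of _ n r]) (auto intro: carrier_matI carrier_vecI)
    also have "E\<^sup>T *\<^sub>v col J i = M *\<^sub>v col X i"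
      using ir d by (simp add: MX flip: col_mult)
    finally have "pinv M *\<^sub>v (A\<^sup>T *\<^sub>v col PA i) = N *\<^sub>v (c (i + 1) \<cdot>\<^sub>v (M *\<^sub>v col X i))"
      by (simp add: N_def)
    also have "\<dots> = c (i + 1) \<cdot>\<^sub>v (N *\<^sub>v (M *\<^sub>v col X i))"
      by (rule mult_mat_vec[of _ n n]) (use d in \<open>auto intro: carrier_matI carrier_vecI\<close>)
    also have "N *\<^sub>v (M *\<^sub>v col X i) = P *\<^sub>v col X i" using d by (simp add: P_def mat_vec_assoc)
    finally show ?thesis using colX'[OF ir(1)] by simp
  qed
  ultimately show ?thesis using G' by blast
qed

section \<open>Eigenvectors and GSVD components\<close>

lemma one_mat_vec: "dim_vec v = n \<Longrightarrow> 1\<^sub>m n *\<^sub>v v = (v :: real vec)"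
  by (rule one_mult_mat_vec) (auto intro: carrier_vecI)

lemma mat_diag_mult_vec:
  assumes "v \<in> carrier_vec d" "i < d"
  shows "(mat_diag d f *\<^sub>v v) $ i = f i * (v $ i :: real)"
proof -
  have "(mat_diag d f *\<^sub>v v) $ i = (\<Sum>k = 0..<d. (if i = k then f k else 0) * v $ k)"
    using assms by (simp add: mat_diag_def scalar_prod_def)
  also have "\<dots> = f i * v $ i" by (subst sum_single_index[of _ i]) (use assms in auto)
  finally show ?thesis .
qed

text \<open>In the basis \<open>PA\<close> the matrix is diagonal with entries c_i^2 or 0, so an
  eigenvector for \<theta>^2 has coordinates only where c_i^2 = \<theta>^2; positivity of both
  numbers removes the squares.\<close>

lemma GSVD_eigenvector_support:
  assumes gsvd: "is_GSVD m p n r A L q1 q2 q3 c s PA PL X"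
    and w: "w \<in> carrier_vec m"
    and eig: "(A * pinv (A\<^sup>T * A + L\<^sup>T * L) * A\<^sup>T) *\<^sub>v w = \<theta>\<^sup>2 \<cdot>\<^sub>v w" "0 < \<theta>"
    and i: "i < m" "(PA\<^sup>T *\<^sub>v w) $ i \<noteq> 0"
  shows "i < q1 + q2 \<and> c (i + 1) = \<theta>"
proof -
  note gd = GSVD_dims[OF gsvd]
  note d = carrier_matD[OF gd(5)] carrier_vecD[OF w(1)]
  define f where "f i = (if i < q1 + q2 then (c (i + 1))\<^sup>2 else 0)" for i
  define a where "a = PA\<^sup>T *\<^sub>v w"
  have a: "a \<in> carrier_vec m" using d by (auto simp: a_def intro: carrier_vecI)
  have Kw: "PA *\<^sub>v (mat_diag m f *\<^sub>v a) = \<theta>\<^sup>2 \<cdot>\<^sub>v w"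
    using eig(1) d unfolding GSVD_pinv_absorb(4)[OF gsvd] a_def f_def[symmetric]
    by (simp add: mat_vec_assoc mat_diag_def)
  have "mat_diag m f *\<^sub>v a = (PA\<^sup>T * PA) *\<^sub>v (mat_diag m f *\<^sub>v a)"
    using carrier_matD[OF mat_diag_dim[of m f]] by (simp add: GSVD_PA[OF gsvd] one_mat_vec)
  also have "\<dots> = PA\<^sup>T *\<^sub>v (\<theta>\<^sup>2 \<cdot>\<^sub>v w)"
    using d by (simp add: mat_vec_assoc Kw[symmetric] mat_diag_def)
  also have "\<dots> = \<theta>\<^sup>2 \<cdot>\<^sub>v a"
    unfolding a_def by (rule mult_mat_vec[of _ m m]) (use gd w in auto)
  finally have "f i * a $ i = \<theta>\<^sup>2 * a $ i"
    using mat_diag_mult_vec[OF a i(1), of f] a i(1) by auto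
  then have "f i = \<theta>\<^sup>2" using i(2) by (simp add: a_def)
  moreover have "\<theta>\<^sup>2 > 0" using eig(2) by simp
  ultimately have "i < q1 + q2" "(c (i + 1))\<^sup>2 = \<theta>\<^sup>2" by (auto simp: f_def split: if_splits)
  moreover have "0 < c (i + 1)" using GSVD_c_pos[OF gsvd, of "i + 1"] \<open>i < q1 + q2\<close> by auto
  ultimately show ?thesis using eig(2) by (simp add: power2_eq_iff)
qed

text \<open>One reflection per vector. As the values \<theta> are distinct, each reflection acts in
  a different eigenspace and leaves the columns already placed untouched.\<close>

lemma GSVD_with_columns:
  fixes k :: nat
  assumes gsvd: "is_GSVD m p n r A L q1 q2 q3 c s PA PL X"
    and w: "\<And>i. i \<in> {1..k} \<Longrightarrow> w i \<in> carrier_vec m" "\<And>i. i \<in> {1..k} \<Longrightarrow> w i \<bullet> w i = 1"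
    and eig: "\<And>i. i \<in> {1..k} \<Longrightarrow> (A * pinv (A\<^sup>T * A + L\<^sup>T * L) * A\<^sup>T) *\<^sub>v w i = (\<theta> i)\<^sup>2 \<cdot>\<^sub>v w i"
      "\<And>i. i \<in> {1..k} \<Longrightarrow> 0 < \<theta> i"
    and inj: "inj_on \<theta> {1..k}"
  shows "\<exists>PA PL X. is_GSVD m p n r A L q1 q2 q3 c s PA PL X \<and>
    (\<forall>i\<in>{1..k}. \<exists>l<q1 + q2. c (l + 1) = \<theta> i \<and> col PA l = w i)"
  using assms
proof (induction k)
  case 0
  then show ?case by auto
next
  case (Suc k)
  have "inj_on \<theta> {1..k}" using Suc.prems(6) by (rule inj_on_subset) auto
  then obtain PA PL X where 1: "is_GSVD m p n r A L q1 q2 q3 c s PA PL X"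
    "\<forall>i\<in>{1..k}. \<exists>l<q1 + q2. c (l + 1) = \<theta> i \<and> col PA l = w i"
    using Suc by auto
  obtain PA' PL' X' l where 2: "is_GSVD m p n r A L q1 q2 q3 c s PA' PL' X'"
    "l < q1 + q2" "c (l + 1) = \<theta> (Suc k)" "col PA' l = w (Suc k)"
    "\<forall>i<m. c (i + 1) \<noteq> \<theta> (Suc k) \<longrightarrow> col PA' i = col PA i"
    using GSVD_extend[OF 1(1), of "w (Suc k)" "\<theta> (Suc k)"] Suc.prems
      GSVD_eigenvector_support[OF 1(1), of "w (Suc k)" "\<theta> (Suc k)"] by auto
  have "\<exists>l<q1 + q2. c (l + 1) = \<theta> i \<and> col PA' l = w i" if i: "i \<in> {1..Suc k}" for i
  proof (cases "i = Suc k")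
    case True
    then show ?thesis using 2 by auto
  next
    case False
    then have i': "i \<in> {1..k}" using i by auto
    then obtain l' where l': "l' < q1 + q2" "c (l' + 1) = \<theta> i" "col PA l' = w i" using 1(2) by blast
    moreover have "\<theta> i \<noteq> \<theta> (Suc k)" using Suc.prems(6) i False by (auto simp: inj_on_def)
    ultimately show ?thesis using 2(5) GSVD_dims(3)[OF 1(1)] by auto
  qed
  then show ?case using 2(1) by blast
qed

text \<open>The columns of \<open>PA\<close> are placed first and \<open>X\<close> is projected
  last, because every reflection also changes \<open>X\<close>. The vectors \<open>x i\<close> are
  then forced: \<theta> times \<open>x i\<close> and \<theta> times the matching column of the final
  \<open>X\<close> both equal M^+ A^T applied to \<open>w i\<close>.\<close>

lemma exact_nontrivial_GSVD_componentsI: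
  fixes k :: nat
  assumes gsvd: "is_GSVD m p n r A L q1 q2 q3 c s PA PL X"
    and M: "M = A\<^sup>T * A + L\<^sup>T * L"
    and w: "\<And>i. i \<in> {1..k} \<Longrightarrow> w i \<in> carrier_vec m" "\<And>i. i \<in> {1..k} \<Longrightarrow> w i \<bullet> w i = 1"
    and x: "\<And>i. i \<in> {1..k} \<Longrightarrow> x i \<in> carrier_vec n"
    and \<theta>: "\<And>i. i \<in> {1..k} \<Longrightarrow> 0 < \<theta> i" "inj_on \<theta> {1..k}"
    and Ax: "\<And>i. i \<in> {1..k} \<Longrightarrow> A *\<^sub>v x i = \<theta> i \<cdot>\<^sub>v w i"
    and Aw: "\<And>i. i \<in> {1..k} \<Longrightarrow> pinv M *\<^sub>v (A\<^sup>T *\<^sub>v w i) = \<theta> i \<cdot>\<^sub>v x i"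
  shows "exact_nontrivial_GSVD_components m p n r A L ((\<lambda>i. (\<theta> i, sqrt (1 - (\<theta> i)\<^sup>2), w i, x i)) ` {1..k})"
proof -
  note Mc = GSVD_pinv_absorb(1)[OF gsvd, folded M] and Nc = GSVD_pinv_absorb(2)[OF gsvd, folded M]
  have A: "A \<in> carrier_mat m n"
    using gsvd unfolding is_GSVD_def by (auto intro!: carrier_matI)
  have eig: "(A * pinv (A\<^sup>T * A + L\<^sup>T * L) * A\<^sup>T) *\<^sub>v w i = (\<theta> i)\<^sup>2 \<cdot>\<^sub>v w i" if i: "i \<in> {1..k}" for i
  proof -
    have "(A * pinv M * A\<^sup>T) *\<^sub>v w i = A *\<^sub>v (pinv M *\<^sub>v (A\<^sup>T *\<^sub>v w i))"
      using carrier_matD[OF A] carrier_matD[OF Nc] carrier_vecD[OF w(1)[OF i]] by (simp add: mat_vec_assoc)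
    also have "\<dots> = \<theta> i \<cdot>\<^sub>v (A *\<^sub>v x i)"
      unfolding Aw[OF i] by (rule mult_mat_vec[OF A x[OF i]])
    finally show ?thesis by (simp add: Ax[OF i] M smult_smult_assoc power2_eq_square)
  qed
  obtain PA' PL' X' where 1: "is_GSVD m p n r A L q1 q2 q3 c s PA' PL' X'"
    "\<forall>i\<in>{1..k}. \<exists>l<q1 + q2. c (l + 1) = \<theta> i \<and> col PA' l = w i"
    using GSVD_with_columns[OF gsvd w eig \<theta>] by blast
  obtain X'' where 2: "is_GSVD m p n r A L q1 q2 q3 c s PA' PL' X''"
    "\<forall>i<r. col X'' i \<in> vec_space.col_space n M"
    "\<forall>i<q1 + q2. pinv M *\<^sub>v (A\<^sup>T *\<^sub>v col PA' i) = c (i + 1) \<cdot>\<^sub>v col X'' i"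
    using GSVD_project[OF 1(1) M] by blast
  note gd = GSVD_dims[OF 2(1)]
  have "\<exists>l\<in>{1..r}. l \<le> m \<and> (\<theta> i, sqrt (1 - (\<theta> i)\<^sup>2), w i, x i) = (c l, s l, col PA' (l - 1), col X'' (l - 1))"
    if i: "i \<in> {1..k}" for i
  proof -
    obtain l where l: "l < q1 + q2" "c (l + 1) = \<theta> i" "col PA' l = w i" using 1(2) i by blast
    have "\<theta> i \<cdot>\<^sub>v x i = \<theta> i \<cdot>\<^sub>v col X'' l" using 2(3) l Aw[OF i] by metis
    then have "inverse (\<theta> i) \<cdot>\<^sub>v (\<theta> i \<cdot>\<^sub>v x i) = inverse (\<theta> i) \<cdot>\<^sub>v (\<theta> i \<cdot>\<^sub>v col X'' l)" by simp
    then have "x i = col X'' l" using \<theta>(1)[OF i] by (simp add: smult_smult_assoc)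
    moreover have "s (l + 1) = sqrt (1 - (\<theta> i)\<^sup>2)"
      using GSVD_s_eq[OF 2(1), of "l + 1"] l gd by auto
    ultimately show ?thesis using l gd by (intro bexI[of _ "l + 1"]) auto
  qed
  moreover have "\<forall>i\<in>{1..r}. col X'' (i - 1) \<in> vec_space.col_space n (A\<^sup>T * A + L\<^sup>T * L)"
    using 2(2) by (auto simp: M)
  ultimately show ?thesis
    unfolding exact_nontrivial_GSVD_components_def using 2(1) by blast
qed

section \<open>The spaces G_j as ranges, and their orthogonal projections\<close>

text \<open>Replacing the unwanted columns of \<open>PA\<close> by zero does not change the span of
  the others, so the span is the column space of \<open>PA * D\<close> with a 0-1 diagonal
  \<open>D\<close>. In this form projections and eigenvalue equations are matrix algebra.\<close>

lemma GSVD_pA_span: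
  assumes gsvd: "is_GSVD m p n r A L q1 q2 q3 c s PA PL X" and \<sigma>: "0 < \<sigma>"
  defines "D \<equiv> mat_diag m (\<lambda>i. if i < q1 + q2 \<and> c (i + 1) = \<sigma> then 1 else 0)"
  shows "pA_span m r c PA \<sigma> = {PA *\<^sub>v (D *\<^sub>v y) | y. y \<in> carrier_vec m}"
proof -
  interpret vec_space "TYPE(real)" m .
  note gd = GSVD_dims[OF gsvd]
  have D: "D \<in> carrier_mat m m" by (simp add: D_def)
  note d = carrier_matD[OF gd(5)] carrier_matD[OF D]
  define T where "T = {col PA (i - 1) | i. i \<in> {1..r} \<and> c i = \<sigma>}"
  have T: "T = {col PA i | i. i < q1 + q2 \<and> c (i + 1) = \<sigma>}"
  proof -
    have "i - 1 < q1 + q2" "i = i - 1 + 1" if "i \<in> {1..r}" "c i = \<sigma>" for i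
      using GSVD_c_zero[OF gsvd, of i] that \<sigma> by (cases "i \<le> q1 + q2"; force)+
    moreover have "i + 1 \<in> {1..r}" if "i < q1 + q2" for i using that gd by auto
    ultimately show ?thesis unfolding T_def by (metis (no_types, lifting) add_diff_cancel_right')
  qed
  have Tc: "T \<subseteq> carrier_vec m" using d gd by (auto simp: T intro: carrier_vecI)
  have colD: "col (PA * D) i = (if i < q1 + q2 \<and> c (i + 1) = \<sigma> then col PA i else 0\<^sub>v m)" if "i < m" for i
  proof (rule eq_vecI)
    fix j assume "j < dim_vec (if i < q1 + q2 \<and> c (i + 1) = \<sigma> then col PA i else 0\<^sub>v m)"
    then have j: "j < m" using d by (auto split: if_splits)
    show "col (PA * D) i $ j = (if i < q1 + q2 \<and> c (i + 1) = \<sigma> then col PA i else 0\<^sub>v m) $ j"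
      using j that d unfolding D_def by (subst mat_diag_mult_right[OF gd(5)]) auto
  qed (use d in auto)
  have "span (set (cols (PA * D))) = span T"
  proof
    show "span (set (cols (PA * D))) \<subseteq> span T"
    proof (rule span_is_subset)
      show sub: "submodule class_ring (span T) V" by (rule span_is_submodule) (use Tc in simp)
      have "0\<^sub>v m \<in> span T" using submodule.zero_closed[OF sub] by simp
      moreover have "T \<subseteq> span T" by (rule in_own_span) (use Tc in simp)
      ultimately show "set (cols (PA * D)) \<subseteq> span T"
        using d by (force simp: cols_def colD T)
    qed
    show "span T \<subseteq> span (set (cols (PA * D)))"
    proof (rule span_is_monotone)
      show "T \<subseteq> set (cols (PA * D))"
      proof
        fix y assume "y \<in> T"
        then obtain i where i: "i < q1 + q2" "c (i + 1) = \<sigma>" "y = col PA i" by (auto simp: T)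
        then have "y = col (PA * D) i" using gd colD[of i] by auto
        then show "y \<in> set (cols (PA * D))" using i gd d by (auto simp: cols_def)
      qed
    qed
  qed
  moreover have "pA_span m r c PA \<sigma> = span T" by (simp add: pA_span_def T_def)
  moreover have "span (set (cols (PA * D))) = {PA *\<^sub>v (D *\<^sub>v y) | y. y \<in> carrier_vec m}"
    unfolding col_space_def[symmetric]
    by (subst col_space_eq[of _ m]) (use d in \<open>auto simp: mat_vec_assoc intro: carrier_matI carrier_vecI\<close>)
  ultimately show ?thesis by simp
qed

lemma scalar_prod_minus_left:
  "dim_vec y = dim_vec x \<Longrightarrow> dim_vec z = dim_vec x \<Longrightarrow> (x - y) \<bullet> z = x \<bullet> z - y \<bullet> (z :: real vec)"
  by (rule minus_scalar_prod_distrib) (auto intro: carrier_vecI)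

text \<open>\<open>G\<close> is an arbitrary set, so the difference of two candidates need not lie
  in it. Orthogonality is applied to each candidate separately, and together the four relations give
  the difference length zero.\<close>

lemma proj_onto_eqI:
  assumes G: "G \<subseteq> carrier_vec m" and b: "b \<in> carrier_vec m"
    and w: "w \<in> G" "\<forall>g\<in>G. (b - w) \<bullet> g = 0"
  shows "proj_onto G b = w"
  unfolding proj_onto_def
proof (rule the_equality)
  fix z assume z: "z \<in> G \<and> (\<forall>g\<in>G. (b - z) \<bullet> g = 0)"
  have d: "dim_vec b = m" "dim_vec w = m" "dim_vec z = m" using G b w z by (auto dest: carrier_vecD)
  have "z \<bullet> z = w \<bullet> z" "z \<bullet> w = w \<bullet> w"
    using w z d by (force simp: scalar_prod_minus_left)+
  moreover have "(z - w) \<bullet> (z - w) = z \<bullet> (z - w) - w \<bullet> (z - w)"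
    using d by (simp add: scalar_prod_minus_left)
  moreover have "z \<bullet> (z - w) = z \<bullet> z - z \<bullet> w" "w \<bullet> (z - w) = w \<bullet> z - w \<bullet> w"
    using d by (auto intro!: scalar_prod_minus_distrib[of _ m] intro: carrier_vecI)
  ultimately have "(z - w) \<bullet> (z - w) = 0" by simp
  then have "z - w = 0\<^sub>v m" by (rule scalar_prod_self_eq_0) (use d in \<open>auto intro: carrier_vecI\<close>)
  then have "z $ i - w $ i = 0" if "i < m" for i
    using that d by (metis index_minus_vec(1) index_zero_vec(1))
  then show "z = w" using d by (intro eq_vecI) auto
qed (use w in auto)

text \<open>The projection is PA D PA^T b: the map D PA^T takes the same value on it and on
  \<open>b\<close>, so their difference is orthogonal to the range of PA D. This existence is what
  gives the definite description in \<open>proj_onto\<close> a meaning.\<close>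

lemma GSVD_proj:
  assumes gsvd: "is_GSVD m p n r A L q1 q2 q3 c s PA PL X" and \<sigma>: "0 < \<sigma>" and b: "b \<in> carrier_vec m"
  defines "G \<equiv> pA_span m r c PA \<sigma>"
  shows "G \<subseteq> carrier_vec m" "proj_onto G b \<in> G" "\<And>g. g \<in> G \<Longrightarrow> (b - proj_onto G b) \<bullet> g = 0"
proof -
  define D where "D = mat_diag m (\<lambda>i. if i < q1 + q2 \<and> c (i + 1) = \<sigma> then 1 else 0 :: real)"
  have G: "G = {PA *\<^sub>v (D *\<^sub>v y) | y. y \<in> carrier_vec m}"
    unfolding G_def D_def by (rule GSVD_pA_span[OF gsvd \<sigma>])
  note gd = GSVD_dims[OF gsvd]
  have D: "D \<in> carrier_mat m m" by (simp add: D_def)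
  note d = carrier_matD[OF gd(5)] carrier_matD[OF D] carrier_vecD[OF b]
  show Gc: "G \<subseteq> carrier_vec m" using d by (auto simp: G intro: carrier_vecI)
  define w where "w = PA *\<^sub>v (D *\<^sub>v (PA\<^sup>T *\<^sub>v b))"
  have "PA\<^sup>T *\<^sub>v b \<in> carrier_vec m" using d by (auto intro: carrier_vecI)
  then have wG: "w \<in> G" unfolding G w_def by blast
  have wd: "dim_vec w = m" using d by (simp add: w_def)
  have Dt: "D\<^sup>T = D" by (rule eq_matI) (auto simp: D_def mat_diag_def)
  have DD: "D * D = D" unfolding D_def by (simp, rule arg_cong[of _ _ "mat_diag m"]) auto
  have orth: "\<forall>g\<in>G. (b - w) \<bullet> g = 0"
  proof
    fix g assume "g \<in> G"
    then obtain y where y: "y \<in> carrier_vec m" "g = PA *\<^sub>v (D *\<^sub>v y)" by (auto simp: G)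
    have gd: "dim_vec g = m" using d y by simp
    have *: "z \<bullet> g = (D *\<^sub>v (PA\<^sup>T *\<^sub>v z)) \<bullet> y" if "dim_vec z = m" for z
    proof -
      have "z \<bullet> g = g \<bullet> z" using that gd by (intro comm_scalar_prod[of _ m]) (auto intro: carrier_vecI)
      also have "\<dots> = y \<bullet> (D *\<^sub>v (PA\<^sup>T *\<^sub>v z))"
        using y d that by (simp add: mat_vec_adjoint Dt)
      also have "\<dots> = (D *\<^sub>v (PA\<^sup>T *\<^sub>v z)) \<bullet> y"
        by (rule comm_scalar_prod[of _ m]) (use y d in \<open>auto intro: carrier_vecI\<close>)
      finally show ?thesis .
    qed
    have "D *\<^sub>v (PA\<^sup>T *\<^sub>v w) = D *\<^sub>v ((PA\<^sup>T * PA) *\<^sub>v (D *\<^sub>v (PA\<^sup>T *\<^sub>v b)))"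
      unfolding w_def using d by (simp add: mat_vec_assoc)
    also have "\<dots> = (D * D) *\<^sub>v (PA\<^sup>T *\<^sub>v b)"
      using d by (simp add: GSVD_PA[OF gsvd] mat_vec_assoc one_mat_vec)
    finally have "D *\<^sub>v (PA\<^sup>T *\<^sub>v w) = D *\<^sub>v (PA\<^sup>T *\<^sub>v b)" by (simp only: DD)
    then have "b \<bullet> g = w \<bullet> g" using * d wd by simp
    then show "(b - w) \<bullet> g = 0" using d wd gd by (simp add: scalar_prod_minus_left)
  qed
  have pw: "proj_onto G b = w" by (rule proj_onto_eqI[OF Gc b wG orth])
  show "proj_onto G b \<in> G" using wG pw by simp
  show "\<And>g. g \<in> G \<Longrightarrow> (b - proj_onto G b) \<bullet> g = 0" using orth pw by simp
qed

lemma GSVD_pA_span_eigenvector: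
  assumes gsvd: "is_GSVD m p n r A L q1 q2 q3 c s PA PL X" and \<sigma>: "0 < \<sigma>"
    and g: "g \<in> pA_span m r c PA \<sigma>"
  shows "(A * pinv (A\<^sup>T * A + L\<^sup>T * L) * A\<^sup>T) *\<^sub>v g = \<sigma>\<^sup>2 \<cdot>\<^sub>v g"
proof -
  define D where "D = mat_diag m (\<lambda>i. if i < q1 + q2 \<and> c (i + 1) = \<sigma> then 1 else 0 :: real)"
  define F where "F = mat_diag m (\<lambda>i. if i < q1 + q2 then (c (i + 1))\<^sup>2 else 0)"
  note gd = GSVD_dims[OF gsvd]
  have D: "D \<in> carrier_mat m m" and F: "F \<in> carrier_mat m m" by (simp_all add: D_def F_def)
  note d = carrier_matD[OF gd(5)] carrier_matD[OF D] carrier_matD[OF F]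
  obtain y where y: "y \<in> carrier_vec m" "g = PA *\<^sub>v (D *\<^sub>v y)"
    using g unfolding GSVD_pA_span[OF gsvd \<sigma>] D_def by blast
  have FD: "F * D = \<sigma>\<^sup>2 \<cdot>\<^sub>m D"
    unfolding F_def D_def mat_diag_diag by (rule eq_matI) (auto simp: mat_diag_def)
  have "(PA * F * PA\<^sup>T) *\<^sub>v g = PA *\<^sub>v (F *\<^sub>v ((PA\<^sup>T * PA) *\<^sub>v (D *\<^sub>v y)))"
    using d y by (simp add: mat_vec_assoc)
  also have "\<dots> = PA *\<^sub>v ((F * D) *\<^sub>v y)"
    using d y by (simp add: GSVD_PA[OF gsvd] mat_vec_assoc one_mat_vec)
  also have "(F * D) *\<^sub>v y = \<sigma>\<^sup>2 \<cdot>\<^sub>v (D *\<^sub>v y)"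
    unfolding FD using D y by (auto simp: scalar_prod_def sum_distrib_left mult.assoc)
  also have "PA *\<^sub>v (\<sigma>\<^sup>2 \<cdot>\<^sub>v (D *\<^sub>v y)) = \<sigma>\<^sup>2 \<cdot>\<^sub>v g"
    unfolding y(2) by (rule mult_mat_vec[OF gd(5)]) (use d in \<open>auto intro: carrier_vecI\<close>)
  finally show ?thesis unfolding GSVD_pinv_absorb(4)[OF gsvd] F_def .
qed

lemma GSVD_eigenvector_in_pA_span:
  assumes gsvd: "is_GSVD m p n r A L q1 q2 q3 c s PA PL X"
    and w: "w \<in> carrier_vec m"
    and eig: "(A * pinv (A\<^sup>T * A + L\<^sup>T * L) * A\<^sup>T) *\<^sub>v w = \<theta>\<^sup>2 \<cdot>\<^sub>v w" "0 < \<theta>"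
  shows "w \<in> pA_span m r c PA \<theta>"
    and "w \<noteq> 0\<^sub>v m \<Longrightarrow> \<exists>i<q1 + q2. c (i + 1) = \<theta>"
proof -
  define D where "D = mat_diag m (\<lambda>i. if i < q1 + q2 \<and> c (i + 1) = \<theta> then 1 else 0 :: real)"
  note gd = GSVD_dims[OF gsvd]
  have D: "D \<in> carrier_mat m m" by (simp add: D_def)
  note d = carrier_matD[OF gd(5)] carrier_matD[OF D] carrier_vecD[OF w]
  define a where "a = PA\<^sup>T *\<^sub>v w"
  have a: "a \<in> carrier_vec m" using d by (auto simp: a_def intro: carrier_vecI)
  have supp: "i < q1 + q2 \<and> c (i + 1) = \<theta>" if "i < m" "a $ i \<noteq> 0" for i
    using GSVD_eigenvector_support[OF gsvd w eig] that by (simp add: a_def)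
  have "(PA * PA\<^sup>T) *\<^sub>v w = PA *\<^sub>v a" unfolding a_def using d by (simp add: mat_vec_assoc)
  then have wa: "w = PA *\<^sub>v a" using w by (simp add: GSVD_PA[OF gsvd])
  have "D *\<^sub>v a = a"
  proof (rule eq_vecI)
    fix i assume "i < dim_vec a"
    then have i: "i < m" using a by simp
    show "(D *\<^sub>v a) $ i = a $ i"
      using mat_diag_mult_vec[OF a i] supp[OF i] by (cases "a $ i = 0") (auto simp: D_def)
  qed (use a d in auto)
  then have "w = PA *\<^sub>v (D *\<^sub>v a)" using wa by simp
  then show "w \<in> pA_span m r c PA \<theta>"
    unfolding GSVD_pA_span[OF gsvd eig(2)] D_def[symmetric] using a by blast
  show "\<exists>i<q1 + q2. c (i + 1) = \<theta>" if "w \<noteq> 0\<^sub>v m"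
  proof (rule ccontr)
    assume "\<not> ?thesis"
    then have "a = 0\<^sub>v m" using supp a by (intro eq_vecI) auto
    then show False using that wa d by (simp add: mat_vec_zero)
  qed
qed

section \<open>The bidiagonal recurrence\<close>

text \<open>Here \<open>f i j\<close>, \<open>g i j\<close>, \<open>h i j\<close> stand for \<open>u i \<bullet> u j\<close>, \<open>v i \<bullet> (M *\<^sub>v v j)\<close> and \<open>u i \<bullet> (A *\<^sub>v v j)\<close>.\<close>

lemma two_sided_recurrence_orthogonal:
  fixes f g h :: "nat \<Rightarrow> nat \<Rightarrow> real" and \<alpha> \<beta> :: "nat \<Rightarrow> real"
  assumes rg: "\<And>i j. 1 \<le> i \<Longrightarrow> 1 \<le> j \<Longrightarrow> \<alpha> i * g i j = h i j - \<beta> i * g (i - 1) j"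
    and rf: "\<And>i j. 1 \<le> i \<Longrightarrow> 1 \<le> j \<Longrightarrow> \<beta> (i + 1) * f (i + 1) j = h j i - \<alpha> i * f i j"
    and sym: "\<And>i j. f i j = f j i" "\<And>i j. g i j = g j i"
    and g0: "\<And>j. g 0 j = 0"
    and f1: "\<And>i. 1 \<le> i \<Longrightarrow> \<beta> i \<noteq> 0 \<Longrightarrow> f i i = 1"
    and f0: "\<And>i j. 1 \<le> i \<Longrightarrow> \<beta> i = 0 \<Longrightarrow> f i j = 0"
    and g1: "\<And>i. 1 \<le> i \<Longrightarrow> \<alpha> i \<noteq> 0 \<Longrightarrow> g i i = 1"
    and pos: "\<And>i. i \<in> {1..k} \<Longrightarrow> \<alpha> i \<noteq> 0 \<and> \<beta> i \<noteq> 0"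
  shows "i \<in> {1..k + 1} \<Longrightarrow> j \<in> {1..k + 1} \<Longrightarrow> i \<noteq> j \<Longrightarrow> f i j = 0"
proof -
  \<comment> \<open>Each step gains first the next \<open>v\<close> and then the next
    \<open>u\<close>, so the \<open>u\<close> side is always one index ahead. Both times the mixed
    products \<open>h\<close> are eliminated between the two recurrences.\<close>
  have main: "(\<forall>i\<in>{1..l + 1}. \<forall>j\<in>{1..<i}. f i j = 0) \<and> (\<forall>i\<in>{1..l}. \<forall>j\<in>{1..<i}. g i j = 0)"
    if "l \<le> k" for l
    using that
  proof (induction l)
    case 0
    then show ?case by auto
  next
    case (Suc l)
    then have F: "f i j = 0" if "i \<in> {1..l + 1}" "j \<in> {1..l + 1}" "i \<noteq> j" for i j
    proof (cases "j < i")
      case False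
      then have "f j i = 0" using Suc that by auto
      then show ?thesis using sym(1)[of i j] by simp
    qed (use Suc that in auto)
    have G: "g i j = 0" if "i \<in> {1..l}" "j \<in> {1..l}" "i \<noteq> j" for i j
    proof (cases "j < i")
      case False
      then have "g j i = 0" using Suc that by auto
      then show ?thesis using sym(2)[of i j] by simp
    qed (use Suc that in auto)
    define k' where "k' = l + 1"
    have k': "\<alpha> k' \<noteq> 0" "\<beta> k' \<noteq> 0" "1 \<le> k'" using pos[of k'] Suc by (auto simp: k'_def)
    have gk: "g k' j = 0" if j: "j \<in> {1..l}" for j
    proof -
      have "h k' j = \<beta> (j + 1) * f (j + 1) k' + \<alpha> j * f j k'" using rf[of j k'] j k' by simp
      moreover have "f j k' = 0" using F[of j k'] j by (auto simp: k'_def)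
      \<comment> \<open>For \<open>j = l\<close> both sides are \<open>\<beta> k'\<close>, since the
        diagonal values are 1; otherwise both vanish by induction.\<close>
      moreover have "\<beta> (j + 1) * f (j + 1) k' = \<beta> k' * g (k' - 1) j"
      proof (cases "j = l")
        case True
        then show ?thesis using f1[of k'] g1[of l] k' j pos[of l] Suc by (auto simp: k'_def)
      next
        case False
        then have "f (j + 1) k' = 0" "g (k' - 1) j = 0"
          using F[of "j + 1" k'] G[of l j] j by (auto simp: k'_def)
        then show ?thesis by simp
      qed
      ultimately have "\<alpha> k' * g k' j = 0" using rg[of k' j] j k' by simp
      then show ?thesis using k' by simp
    qed
    have fk: "f (k' + 1) j = 0" if j: "j \<in> {1..k'}" for j
    proof (cases "\<beta> (k' + 1) = 0")
      \<comment> \<open>This can only occur at the last index, where \<open>\<beta>\<close> is not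
        known to be nonzero; the zero vector is orthogonal to everything.\<close>
      case True
      then show ?thesis using f0[of "k' + 1" j] by simp
    next
      case False
      have "h j k' = \<alpha> j * g j k' + \<beta> j * g (j - 1) k'" using rg[of j k'] j k' by simp
      moreover have "g (j - 1) k' = 0"
      proof (cases "j = 1")
        case False
        then have "j - 1 \<in> {1..l}" using j unfolding k'_def by (simp, linarith)
        then show ?thesis using gk[of "j - 1"] sym(2)[of "j - 1" k'] by simp
      qed (simp add: g0)
      moreover have "\<alpha> j * g j k' = \<alpha> k' * f k' j"
      proof (cases "j = k'")
        case True
        then show ?thesis using f1[of k'] g1[of k'] k' by simp
      next
        case False
        then have "f k' j = 0" "g j k' = 0"
          using F[of k' j] gk[of j] sym(2)[of j k'] j by (auto simp: k'_def)
        then show ?thesis by simp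
      qed
      ultimately have "\<beta> (k' + 1) * f (k' + 1) j = 0" using rf[of k' j] j k' by simp
      then show ?thesis using False by simp
    qed
    have "f i j = 0" if "i \<in> {1..Suc l + 1}" "j \<in> {1..<i}" for i j
      using that fk[of j] F[of i j] by (cases "i = k' + 1") (auto simp: k'_def)
    moreover have "g i j = 0" if "i \<in> {1..Suc l}" "j \<in> {1..<i}" for i j
      using that gk[of j] G[of i j] by (cases "i = k'") (auto simp: k'_def)
    ultimately show ?case by blast
  qed
  assume "i \<in> {1..k + 1}" "j \<in> {1..k + 1}" "i \<noteq> j"
  then show "f i j = 0" using main[of k] sym(1)[of i j]
    by (cases "j < i") auto
qed

section \<open>Stacked columns, bidiagonal matrices and compact singular value
  decompositions\<close>

lemma seq_mat_dim [simp]: "dim_row (seq_mat d w k) = d" "dim_col (seq_mat d w k) = k"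
  "seq_mat d w k \<in> carrier_mat d k"
  by (auto simp: seq_mat_def)

lemma seq_mat_index: "i < d \<Longrightarrow> j < k \<Longrightarrow> seq_mat d w k $$ (i, j) = w (j + 1) $ i"
  by (auto simp: seq_mat_def mat_of_cols_index simp del: upt_Suc)

lemma col_seq_mat: "j < k \<Longrightarrow> w (j + 1) \<in> carrier_vec d \<Longrightarrow> col (seq_mat d w k) j = w (j + 1)"
  by (rule eq_vecI) (auto simp: seq_mat_index)

lemma bidiag_dim [simp]: "dim_row (bidiag k \<alpha> \<beta>) = k + 1" "dim_col (bidiag k \<alpha> \<beta>) = k"
  "bidiag k \<alpha> \<beta> \<in> carrier_mat (k + 1) k"
  by (auto simp: bidiag_def)

lemma bidiag_mult_vec:
  assumes "h \<in> carrier_vec k" "i \<le> k"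
  shows "(bidiag k \<alpha> \<beta> *\<^sub>v h) $ i =
    (if i < k then \<alpha> (i + 1) * h $ i else 0) + (if 0 < i then \<beta> (i + 1) * h $ (i - 1) else 0)"
proof -
  have "(bidiag k \<alpha> \<beta> *\<^sub>v h) $ i = (\<Sum>j = 0..<k. bidiag k \<alpha> \<beta> $$ (i, j) * h $ j)"
    using assms by (simp add: scalar_prod_def)
  also have "\<dots> =
      (\<Sum>j = 0..<k. (if j = i then \<alpha> (i + 1) * h $ i else 0) + (if j = i - 1 then if 0 < i then \<beta> (i + 1) * h $ (i - 1) else 0 else 0))"
    using assms by (intro sum.cong) (auto simp: bidiag_def)
  also have "\<dots> = (if i < k then \<alpha> (i + 1) * h $ i else 0) + (if 0 < i then \<beta> (i + 1) * h $ (i - 1) else 0)"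
    using assms by (simp add: sum.distrib) linarith
  finally show ?thesis .
qed

lemma bidiag_transpose_mult_vec:
  assumes "y \<in> carrier_vec (k + 1)" "j < k"
  shows "((bidiag k \<alpha> \<beta>)\<^sup>T *\<^sub>v y) $ j = \<alpha> (j + 1) * y $ j + \<beta> (j + 2) * y $ (j + 1)"
proof -
  have "((bidiag k \<alpha> \<beta>)\<^sup>T *\<^sub>v y) $ j = (\<Sum>i = 0..<k + 1. bidiag k \<alpha> \<beta> $$ (i, j) * y $ i)"
    using assms by (simp add: scalar_prod_def)
  also have "\<dots> =
      (\<Sum>i = 0..<k + 1. (if i = j then \<alpha> (j + 1) * y $ j else 0) + (if i = j + 1 then \<beta> (j + 2) * y $ (j + 1) else 0))"
    using assms by (intro sum.cong) (auto simp: bidiag_def)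
  also have "\<dots> = \<alpha> (j + 1) * y $ j + \<beta> (j + 2) * y $ (j + 1)"
    using assms by (simp add: sum.distrib del: sum.op_ivl_Suc)
  finally show ?thesis .
qed

text \<open>A zero first entry of \<open>y\<close> spreads: row 0 of \<open>B h\<close> gives h_0 =
  0, row 0 of B^T y gives y_1 = 0, row 1 of \<open>B h\<close> gives h_1 = 0, and so on until h = 0.
  The divisions are by \<alpha> up to index k and \<beta> from 2 to k, so
  \<open>\<beta> (k + 1)\<close> may vanish.\<close>

lemma bidiag_singular_vector_first:
  assumes h: "h \<in> carrier_vec k" "h \<noteq> 0\<^sub>v k" and y: "y \<in> carrier_vec (k + 1)"
    and \<theta>: "\<theta> \<noteq> 0"
    and Bh: "bidiag k \<alpha> \<beta> *\<^sub>v h = \<theta> \<cdot>\<^sub>v y" and By: "(bidiag k \<alpha> \<beta>)\<^sup>T *\<^sub>v y = \<theta> \<cdot>\<^sub>v h"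
    and pos: "\<And>i. i \<in> {1..k} \<Longrightarrow> \<alpha> i \<noteq> 0 \<and> \<beta> i \<noteq> 0"
  shows "y $ 0 \<noteq> 0"
proof
  assume y0: "y $ 0 = 0"
  have 1: "\<theta> * y $ i = (if i < k then \<alpha> (i + 1) * h $ i else 0) + (if 0 < i then \<beta> (i + 1) * h $ (i - 1) else 0)"
    if "i \<le> k" for i
    using bidiag_mult_vec[OF h(1) that, of \<alpha> \<beta>] y that unfolding Bh by simp
  have 2: "\<theta> * h $ j = \<alpha> (j + 1) * y $ j + \<beta> (j + 2) * y $ (j + 1)" if "j < k" for j
    using bidiag_transpose_mult_vec[OF y that, of \<alpha> \<beta>] h that unfolding By by simp
  have "h $ i = 0 \<and> y $ i = 0" if "i < k" for i
    using that
  proof (induction i)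
    case 0
    then show ?case using 1[of 0] y0 pos[of 1] by simp
  next
    case (Suc i)
    then have "y $ (Suc i) = 0" using 2[of i] pos[of "i + 2"] by simp
    then show ?case using 1[of "Suc i"] Suc pos[of "i + 2"] by simp
  qed
  then have "h = 0\<^sub>v k" using h by (intro eq_vecI) auto
  then show False using h by simp
qed

lemma no_orthonormal_family_above_dim:
  fixes u :: "nat \<Rightarrow> real vec"
  assumes u: "\<And>i. i \<in> {1..m + 1} \<Longrightarrow> u i \<in> carrier_vec m"
    and orth: "\<And>i j. i \<in> {1..m + 1} \<Longrightarrow> j \<in> {1..m + 1} \<Longrightarrow> u i \<bullet> u j = (if i = j then 1 else 0)"
  shows False
proof -
  \<comment> \<open>Pad the \<open>m \<times> (m + 1)\<close> matrix of the family with a zero row: it would be a square isometry, hence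
    invertible, although its last row vanishes.\<close>
  define W where "W = mat (m + 1) (m + 1) (\<lambda>(i, j). if i < m then u (j + 1) $ i else 0)"
  have W: "W \<in> carrier_mat (m + 1) (m + 1)" by (simp add: W_def)
  have "W\<^sup>T * W = 1\<^sub>m (m + 1)"
  proof (rule eq_matI, goal_cases)
    case (1 i j)
    then have ij: "i < m + 1" "j < m + 1" by auto
    have "(W\<^sup>T * W) $$ (i, j) = (\<Sum>k = 0..<m + 1. W $$ (k, i) * W $$ (k, j))"
      using ij W by (simp add: scalar_prod_def)
    also have "\<dots> = (\<Sum>k = 0..<m. u (i + 1) $ k * u (j + 1) $ k)"
      using ij by (simp add: W_def)
    also have "\<dots> = u (i + 1) \<bullet> u (j + 1)"
      using carrier_vecD[OF u[of "j + 1"]] ij by (simp add: scalar_prod_def)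
    finally show ?case using orth[of "i + 1" "j + 1"] ij by simp
  qed (use W in auto)
  then have "W * W\<^sup>T = 1\<^sub>m (m + 1)"
    using W by (intro mat_mult_left_right_inverse[of "W\<^sup>T"]) auto
  moreover have "(W * W\<^sup>T) $$ (m, m) = 0"
    using W by (simp add: scalar_prod_def) (simp add: W_def)
  ultimately show False by simp
qed

text \<open>Column forms of B H = Y D and B^T Y = H D. The last claim comes from B^T = H D Y^T and
  is the test that detects a missed space G_j.\<close>

lemma compact_SVD_vectors:
  assumes svd: "is_compact_SVD k B Y \<theta> H" and B: "B \<in> carrier_mat d k"
  shows "i \<in> {1..k} \<Longrightarrow> col Y (i - 1) \<in> carrier_vec d" "i \<in> {1..k} \<Longrightarrow> col H (i - 1) \<in> carrier_vec k"
    "i \<in> {1..k} \<Longrightarrow> col Y (i - 1) \<bullet> col Y (i - 1) = 1" "i \<in> {1..k} \<Longrightarrow> col H (i - 1) \<bullet> col H (i - 1) = 1"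
    "i \<in> {1..k} \<Longrightarrow> B *\<^sub>v col H (i - 1) = \<theta> i \<cdot>\<^sub>v col Y (i - 1)"
    "i \<in> {1..k} \<Longrightarrow> B\<^sup>T *\<^sub>v col Y (i - 1) = \<theta> i \<cdot>\<^sub>v col H (i - 1)"
    "i \<in> {1..k} \<Longrightarrow> 0 < \<theta> i" "inj_on \<theta> {1..k}"
    "w \<in> carrier_vec d \<Longrightarrow> (\<And>i. i \<in> {1..k} \<Longrightarrow> col Y (i - 1) \<bullet> w = 0) \<Longrightarrow> B\<^sup>T *\<^sub>v w = 0\<^sub>v k"
proof -
  define D where "D = mat_diag k (\<lambda>i. \<theta> (i + 1))"
  have Y: "Y \<in> carrier_mat d k" "Y\<^sup>T * Y = 1\<^sub>m k" and H: "H \<in> carrier_mat k k" "H\<^sup>T * H = 1\<^sub>m k"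
    and B_eq: "B = Y * D * H\<^sup>T"
    using svd B by (auto simp: is_compact_SVD_def orthonormal_cols_def D_def)
  have D: "D \<in> carrier_mat k k" by (simp add: D_def)
  note d = carrier_matD[OF Y(1)] carrier_matD[OF H(1)] carrier_matD[OF D]
  have Dt: "D\<^sup>T = D" by (rule eq_matI) (auto simp: D_def mat_diag_def)
  have BH: "B * H = Y * D" using d by (simp add: B_eq mat_mult_assoc H mat_mult_one)
  have Bt: "B\<^sup>T = H * (D * Y\<^sup>T)" unfolding B_eq using d by (simp add: mat_mult_transpose Dt mat_mult_assoc)
  have BY: "B\<^sup>T * Y = H * D" using d by (simp add: Bt mat_mult_assoc Y mat_mult_one)
  have colD: "col (Z * D) j = \<theta> (j + 1) \<cdot>\<^sub>v col Z j" if "Z \<in> carrier_mat e k" "j < k" for Z j e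
    unfolding D_def mat_diag_mult_right[OF that(1)] using that by (intro eq_vecI) auto
  have unit: "col Z j \<bullet> col Z j = 1" if "Z\<^sup>T * Z = 1\<^sub>m k" "Z \<in> carrier_mat e k" "j < k" for Z :: "real mat" and j e
  proof -
    have "(Z\<^sup>T * Z) $$ (j, j) = 1" unfolding that(1) using that(3) by simp
    then show ?thesis using that(2,3) by simp
  qed
  show "inj_on \<theta> {1..k}"
  proof (rule inj_onI)
    fix i j assume ij: "i \<in> {1..k}" "j \<in> {1..k}" "\<theta> i = \<theta> j"
    have *: "\<theta> j < \<theta> i" if "i \<in> {1..k}" "j \<in> {1..k}" "i < j" for i j
      using svd that unfolding is_compact_SVD_def by blast
    show "i = j"
      using *[OF ij(1,2)] *[OF ij(2,1)] ij(3) by (cases i j rule: linorder_cases) auto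
  qed
  show "B\<^sup>T *\<^sub>v w = 0\<^sub>v k" if "w \<in> carrier_vec d" "\<And>i. i \<in> {1..k} \<Longrightarrow> col Y (i - 1) \<bullet> w = 0"
  proof -
    have "Y\<^sup>T *\<^sub>v w = 0\<^sub>v k" using that(2)[of "_ + 1"] d by (intro eq_vecI) auto
    then show ?thesis using d that(1) by (simp add: Bt mat_vec_assoc mat_vec_zero)
  qed
  assume i: "i \<in> {1..k}"
  then have j: "i - 1 < k" "i - 1 + 1 = i" by auto
  show "0 < \<theta> i" using svd i by (auto simp: is_compact_SVD_def)
  show "col Y (i - 1) \<in> carrier_vec d" "col H (i - 1) \<in> carrier_vec k" using d by (auto intro: carrier_vecI)
  show "col Y (i - 1) \<bullet> col Y (i - 1) = 1" "col H (i - 1) \<bullet> col H (i - 1) = 1"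
    using unit[OF Y(2,1) j(1)] unit[OF H(2,1) j(1)] by auto
  have "B *\<^sub>v col H (i - 1) = col (B * H) (i - 1)"
    using B d j by (simp add: col_mult)
  then show "B *\<^sub>v col H (i - 1) = \<theta> i \<cdot>\<^sub>v col Y (i - 1)" using colD[OF Y(1) j(1)] j(2) by (simp add: BH)
  have "B\<^sup>T *\<^sub>v col Y (i - 1) = col (B\<^sup>T * Y) (i - 1)"
    using B d j by (simp add: col_mult)
  then show "B\<^sup>T *\<^sub>v col Y (i - 1) = \<theta> i \<cdot>\<^sub>v col H (i - 1)" using colD[OF H(1) j(1)] j(2) by (simp add: BY)
qed

section \<open>The gGKB process and its terminate step\<close>

context
  fixes m n :: nat and A M :: "real mat" and b :: "real vec"
    and u v :: "nat \<Rightarrow> real vec" and \<alpha> \<beta> :: "nat \<Rightarrow> real"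
  assumes gGKB: "gGKB m n A M b u v \<alpha> \<beta>"
    and A: "A \<in> carrier_mat m n" and M: "M \<in> carrier_mat n n" and Mt: "M\<^sup>T = M"
    and N: "pinv M \<in> carrier_mat n n" and absorb: "M * pinv M * A\<^sup>T = A\<^sup>T"
begin

lemma gGKB_carrier: "1 \<le> i \<Longrightarrow> u i \<in> carrier_vec m" "v i \<in> carrier_vec n"
  using gGKB by (auto simp: gGKB_def) (metis One_nat_def less_one linorder_not_le zero_carrier_vec)

lemma gGKB_rec_v: "1 \<le> i \<Longrightarrow> \<alpha> i \<cdot>\<^sub>v v i = pinv M *\<^sub>v (A\<^sup>T *\<^sub>v u i) - \<beta> i \<cdot>\<^sub>v v (i - 1)"
  using gGKB by (simp add: gGKB_def)

lemma gGKB_rec_u: "1 \<le> i \<Longrightarrow> \<beta> (i + 1) \<cdot>\<^sub>v u (i + 1) = A *\<^sub>v v i - \<alpha> i \<cdot>\<^sub>v u i"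
  using gGKB by (simp add: gGKB_def)

text \<open>Testing the \<open>v\<close> recurrence against \<open>M *\<^sub>v v j\<close> and the
  \<open>u\<close> recurrence against \<open>u j\<close> produces the same mixed products u_i^T A
  v_j, because \<open>absorb\<close> cancels M M^+. The range reaches k + 1, where u may be the zero
  vector; hence the condition on \<beta>.\<close>

lemma gGKB_orthonormal:
  assumes pos: "\<And>i. i \<in> {1..k} \<Longrightarrow> \<alpha> i \<noteq> 0 \<and> \<beta> i \<noteq> 0"
    and ij: "i \<in> {1..k + 1}" "j \<in> {1..k + 1}"
  shows "u i \<bullet> u j = (if i = j \<and> \<beta> i \<noteq> 0 then 1 else 0)"
proof -
  note dA = carrier_matD[OF A] carrier_matD[OF M] carrier_matD[OF N]
  note dv = carrier_vecD[OF gGKB_carrier(2)] and du = carrier_vecD[OF gGKB_carrier(1)]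
  \<comment> \<open>\<open>u 0\<close> is unconstrained, while the recurrence lemma wants symmetry
    at all indices, so index 0 is set to zero by hand.\<close>
  define f where "f i j = (if i = 0 \<or> j = 0 then 0 else u i \<bullet> u j)" for i j
  define g where "g i j = v i \<bullet> (M *\<^sub>v v j)" for i j
  define h where "h i j = u i \<bullet> (A *\<^sub>v v j)" for i j
  have f1: "f i i = 1" if "1 \<le> i" "\<beta> i \<noteq> 0" for i
    using gGKB that by (auto simp: gGKB_def norm2_def f_def)
  have f0: "f i j = 0" if "1 \<le> i" "\<beta> i = 0" for i j
    using gGKB that gGKB_carrier(1)[of j] by (auto simp: gGKB_def f_def)
  have "i \<noteq> j \<Longrightarrow> f i j = 0"
  proof (rule two_sided_recurrence_orthogonal[of \<alpha> g h \<beta> f k])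
    fix i j :: nat assume i: "1 \<le> i" and j: "1 \<le> j"
    have "(\<alpha> i \<cdot>\<^sub>v v i) \<bullet> (M *\<^sub>v v j) =
        (pinv M *\<^sub>v (A\<^sup>T *\<^sub>v u i)) \<bullet> (M *\<^sub>v v j) - (\<beta> i \<cdot>\<^sub>v v (i - 1)) \<bullet> (M *\<^sub>v v j)"
      unfolding gGKB_rec_v[OF i] using dA dv by (simp add: scalar_prod_minus_left)
    moreover have "(pinv M *\<^sub>v (A\<^sup>T *\<^sub>v u i)) \<bullet> (M *\<^sub>v v j) = h i j"
    proof -
      have "(pinv M *\<^sub>v (A\<^sup>T *\<^sub>v u i)) \<bullet> (M *\<^sub>v v j) = (M *\<^sub>v v j) \<bullet> (pinv M *\<^sub>v (A\<^sup>T *\<^sub>v u i))"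
        using dA by (intro comm_scalar_prod[of _ n]) (auto intro: carrier_vecI)
      also have "\<dots> = v j \<bullet> ((M * pinv M * A\<^sup>T) *\<^sub>v u i)"
        using dA dv du[OF i] by (simp add: mat_vec_adjoint Mt mat_vec_assoc)
      also have "\<dots> = (A *\<^sub>v v j) \<bullet> u i"
        using dA dv du[OF i] by (simp add: absorb mat_vec_adjoint)
      also have "\<dots> = h i j"
        unfolding h_def using dA du[OF i] by (intro comm_scalar_prod[of _ m]) (auto intro: carrier_vecI)
      finally show ?thesis .
    qed
    ultimately show "\<alpha> i * g i j = h i j - \<beta> i * g (i - 1) j"
      using dA dv by (simp add: g_def)
    have "(\<beta> (i + 1) \<cdot>\<^sub>v u (i + 1)) \<bullet> u j = (A *\<^sub>v v i) \<bullet> u j - (\<alpha> i \<cdot>\<^sub>v u i) \<bullet> u j"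
      unfolding gGKB_rec_u[OF i] using dA du[OF i] du[OF j] by (simp add: scalar_prod_minus_left)
    moreover have "(A *\<^sub>v v i) \<bullet> u j = h j i"
      unfolding h_def using dA du[OF j] by (intro comm_scalar_prod[of _ m]) (auto intro: carrier_vecI)
    ultimately show "\<beta> (i + 1) * f (i + 1) j = h j i - \<alpha> i * f i j"
      using du[OF i] du[OF j] du[of "i + 1"] i j by (simp add: f_def)
  next
    fix i j
    show "f i j = f j i"
      unfolding f_def using gGKB_carrier(1)[of i] gGKB_carrier(1)[of j] by (auto intro: comm_scalar_prod)
    have "g i j = (M *\<^sub>v v j) \<bullet> v i"
      unfolding g_def using dA dv by (intro comm_scalar_prod[of _ n]) (auto intro: carrier_vecI)
    then show "g i j = g j i"
      using dA dv by (simp add: g_def mat_vec_adjoint Mt)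
  next
    show "g 0 j = 0" for j
      using gGKB dA by (auto simp: gGKB_def g_def intro!: scalar_prod_left_zero intro: carrier_vecI)
    show "g i i = 1" if "1 \<le> i" "\<alpha> i \<noteq> 0" for i
      using gGKB that by (auto simp: gGKB_def norm_wrt_def g_def)
  qed (use f1 f0 pos ij in auto)
  then show ?thesis using ij f1[of i] f0[of i j] by (cases "i = j") (auto simp: f_def)
qed

text \<open>Otherwise m + 1 of the vectors \<open>u\<close> would be orthonormal in dimension
  \<open>m\<close>. Without this the LEAST in \<open>terminate_step\<close> would carry no
  information.\<close>

lemma gGKB_terminates: "\<exists>k. \<alpha> (k + 1) * \<beta> (k + 1) = 0"
proof (rule ccontr)
  assume "\<not> ?thesis"
  then have "\<alpha> i \<noteq> 0 \<and> \<beta> i \<noteq> 0" if "1 \<le> i" for i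
    using that by (metis le_add_diff_inverse2 mult_eq_0_iff)
  then show False
    using gGKB_orthonormal[of "m + 1"] gGKB_carrier(1) by (intro no_orthonormal_family_above_dim[of m u]) auto
qed

text \<open>Both ways of stopping end with \<open>\<alpha> (k + 1) = 0\<close>, since the convention
  for \<open>\<beta> (k + 1) = 0\<close> includes it.\<close>

lemma gGKB_terminate_step:
  "k = terminate_step \<alpha> \<beta> \<Longrightarrow> i \<in> {1..k} \<Longrightarrow> \<alpha> i \<noteq> 0 \<and> \<beta> i \<noteq> 0"
  "k = terminate_step \<alpha> \<beta> \<Longrightarrow> \<alpha> (k + 1) = 0"
proof -
  assume k: "k = terminate_step \<alpha> \<beta>"
  have "\<alpha> (k + 1) * \<beta> (k + 1) = 0"
    unfolding k terminate_step_def by (rule LeastI_ex) (rule gGKB_terminates)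
  moreover have "\<beta> (k + 1) = 0 \<Longrightarrow> \<alpha> (k + 1) = 0" using gGKB by (auto simp: gGKB_def)
  ultimately show "\<alpha> (k + 1) = 0" by auto
  assume i: "i \<in> {1..k}"
  then have "i - 1 < (LEAST k. \<alpha> (k + 1) * \<beta> (k + 1) = 0)" unfolding k terminate_step_def by auto
  from not_less_Least[OF this] show "\<alpha> i \<noteq> 0 \<and> \<beta> i \<noteq> 0" using i by auto
qed

lemma gGKB_matrix_A: "A * seq_mat n v k = seq_mat m u (k + 1) * bidiag k \<alpha> \<beta>"
proof (rule eq_matI, goal_cases)
  case (1 i j)
  then have ij: "i < m" "j < k" by auto
  note dA = carrier_matD[OF A]
  have "(A * seq_mat n v k) $$ (i, j) = (A *\<^sub>v v (j + 1)) $ i"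
    using ij dA col_seq_mat[of j k v n] gGKB_carrier(2) by simp
  also have "\<dots> = \<alpha> (j + 1) * u (j + 1) $ i + \<beta> (j + 2) * u (j + 2) $ i"
    using arg_cong[OF gGKB_rec_u[of "j + 1"], of "\<lambda>x. x $ i"] ij dA gGKB_carrier(1)[of "j + 1"] gGKB_carrier(1)[of "j + 2"]
    by simp
  also have "\<dots> = ((bidiag k \<alpha> \<beta>)\<^sup>T *\<^sub>v vec (k + 1) (\<lambda>l. u (l + 1) $ i)) $ j"
    using ij by (subst bidiag_transpose_mult_vec) auto
  also have "\<dots> = (\<Sum>l = 0..<k + 1. bidiag k \<alpha> \<beta> $$ (l, j) * u (l + 1) $ i)"
    using ij by (simp add: scalar_prod_def)
  also have "\<dots> = (\<Sum>l = 0..<k + 1. seq_mat m u (k + 1) $$ (i, l) * bidiag k \<alpha> \<beta> $$ (l, j))"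
    using ij by (intro sum.cong) (auto simp: seq_mat_index)
  also have "\<dots> = (seq_mat m u (k + 1) * bidiag k \<alpha> \<beta>) $$ (i, j)"
    using ij by (simp add: scalar_prod_def)
  finally show ?case .
qed (use A in auto)

text \<open>The last column would carry the additional term \<open>\<alpha> (k + 1)\<close> times
  \<open>v (k + 1)\<close>, which the hypothesis removes. The relation for \<open>A\<close> closes
  at every \<open>k\<close>, as \<open>bidiag\<close> has the extra row for u_(k+1).\<close>

lemma gGKB_matrix_pinv:
  assumes "\<alpha> (k + 1) = 0"
  shows "pinv M * A\<^sup>T * seq_mat m u (k + 1) = seq_mat n v k * (bidiag k \<alpha> \<beta>)\<^sup>T"
proof (rule eq_matI, goal_cases)
  case (1 i j)
  then have ij: "i < n" "j < k + 1" by auto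
  note dA = carrier_matD[OF A] carrier_matD[OF N]
  have v0: "v 0 = 0\<^sub>v n" using gGKB by (simp add: gGKB_def)
  have "(pinv M * A\<^sup>T * seq_mat m u (k + 1)) $$ (i, j) = col (pinv M * A\<^sup>T * seq_mat m u (k + 1)) j $ i"
    using ij dA by simp
  also have "\<dots> = (pinv M *\<^sub>v (A\<^sup>T *\<^sub>v u (j + 1))) $ i"
    using ij dA col_seq_mat[of j "k + 1" u m] gGKB_carrier(1)[of "j + 1"]
    by (simp add: col_mult mat_vec_assoc del: index_mult_mat_vec)
  also have "\<dots> = \<alpha> (j + 1) * v (j + 1) $ i + \<beta> (j + 1) * v j $ i"
    using arg_cong[OF gGKB_rec_v[of "j + 1"], of "\<lambda>x. x $ i"] ij dA
      carrier_vecD[OF gGKB_carrier(2)[of "j + 1"]] carrier_vecD[OF gGKB_carrier(2)[of j]]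
    by (simp del: index_mult_mat_vec)
  also have "\<dots> = (bidiag k \<alpha> \<beta> *\<^sub>v vec k (\<lambda>l. v (l + 1) $ i)) $ j"
    using ij assms v0 by (subst bidiag_mult_vec) (auto simp: less_Suc_eq)
  also have "\<dots> = (\<Sum>l = 0..<k. bidiag k \<alpha> \<beta> $$ (j, l) * v (l + 1) $ i)"
    using ij by (simp add: scalar_prod_def)
  also have "\<dots> = (\<Sum>l = 0..<k. seq_mat n v k $$ (i, l) * bidiag k \<alpha> \<beta> $$ (j, l))"
    using ij by (intro sum.cong) (auto simp: seq_mat_index)
  also have "\<dots> = (seq_mat n v k * (bidiag k \<alpha> \<beta>)\<^sup>T) $$ (i, j)"
    using ij by (simp add: scalar_prod_def)
  finally show ?case .
qed (use N in auto)

text \<open>The diagonal has a zero exactly when the process stops with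
  \<open>\<beta> (k + 1) = 0\<close>, in its last place, where the column of \<open>U\<close> is the
  zero vector.\<close>

lemma gGKB_gram_u:
  assumes pos: "\<And>i. i \<in> {1..k} \<Longrightarrow> \<alpha> i \<noteq> 0 \<and> \<beta> i \<noteq> 0"
  shows "(seq_mat m u (k + 1))\<^sup>T * seq_mat m u (k + 1) = mat_diag (k + 1) (\<lambda>i. if \<beta> (i + 1) = 0 then 0 else 1)"
proof (rule eq_matI, goal_cases)
  case (1 i j)
  then have ij: "i < k + 1" "j < k + 1" by (auto simp: mat_diag_def)
  have "((seq_mat m u (k + 1))\<^sup>T * seq_mat m u (k + 1)) $$ (i, j) = u (i + 1) \<bullet> u (j + 1)"
    using ij col_seq_mat[of _ "k + 1" u m] gGKB_carrier(1) by simp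
  then show ?case using gGKB_orthonormal[OF pos, of k "i + 1" "j + 1"] ij by (auto simp: mat_diag_def)
qed (auto simp: mat_diag_def)

end

section \<open>Matching the output tuples with the spaces G_j that b meets\<close>

theorem theorem5p3:
  fixes A L PA PL X M Y H :: "real mat"
    and b :: "real vec"
    and m p n r q1 q2 q3 l kt :: nat
    and c s \<sigma> \<alpha> \<beta> \<theta> :: "nat \<Rightarrow> real"
    and u v :: "nat \<Rightarrow> real vec"
    and G :: "nat \<Rightarrow> real vec set"
    and J :: "nat set"
    and out :: "nat \<Rightarrow> real \<times> real \<times> real vec \<times> real vec"
  assumes A: "A \<in> carrier_mat m n"
    and L: "L \<in> carrier_mat p n"
    and rank: "vec_space.rank (m + p) (A @\<^sub>r L) = r"
    and M: "M = A\<^sup>T * A + L\<^sup>T * L"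
    and gsvd: "is_GSVD m p n r A L q1 q2 q3 c s PA PL X"
    and sigma_inj: "inj_on \<sigma> {1..l}"
    and sigma_vals: "\<sigma> ` {1..l} = {c i | i. i \<in> {1..r} \<and> 0 < c i}"
    and G: "\<And>j. j \<in> {1..l} \<Longrightarrow> G j = pA_span m r c PA (\<sigma> j)"
    and b: "b \<in> carrier_vec m" "b \<noteq> 0\<^sub>v m"
    and gGKB: "gGKB m n A M b u v \<alpha> \<beta>"
    and kt: "kt = terminate_step \<alpha> \<beta>" "1 \<le> kt"
    and svd: "is_compact_SVD kt (bidiag kt \<alpha> \<beta>) Y \<theta> H"
    and J: "J = {j \<in> {1..l}. proj_onto (G j) b \<noteq> 0\<^sub>v m}"
    and out: "\<And>i. i \<in> {1..kt} \<Longrightarrow> out i = gGKB_GSVD_tuple m n kt u v Y \<theta> H i"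
  shows "exact_nontrivial_GSVD_components m p n r A L (out ` {1..kt}) \<and>
    (\<exists>\<tau>. bij_betw \<tau> {1..kt} J \<and>
       (\<forall>i\<in>{1..kt}. case out i of (cbar, sbar, pbar, xbar) \<Rightarrow>
          cbar = \<sigma> (\<tau> i) \<and> pbar \<in> G (\<tau> i)))"
proof -
  define N where "N = pinv M"
  define K where "K = A * N * A\<^sup>T"
  define B where "B = bidiag kt \<alpha> \<beta>"
  define U where "U = seq_mat m u (kt + 1)"
  define V where "V = seq_mat n v kt"
  define y where "y i = col Y (i - 1)" for i
  define h where "h i = col H (i - 1)" for i
  define w where "w i = U *\<^sub>v y i" for i
  define x where "x i = V *\<^sub>v h i" for i
  note gd = GSVD_dims[OF gsvd]
  have Mc: "M \<in> carrier_mat n n" and Nc: "N \<in> carrier_mat n n" and MNA: "M * N * A\<^sup>T = A\<^sup>T"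
    and K_eq: "K = PA * mat_diag m (\<lambda>i. if i < q1 + q2 then (c (i + 1))\<^sup>2 else 0) * PA\<^sup>T"
    using GSVD_pinv_absorb[OF gsvd] by (simp_all add: M N_def K_def)
  have Mt: "M\<^sup>T = M"
  proof -
    have "A\<^sup>T * A \<in> carrier_mat n n" "L\<^sup>T * L \<in> carrier_mat n n" using A L by auto
    then show ?thesis unfolding M by (simp add: transpose_add mat_mult_transpose)
  qed
  have KT: "K\<^sup>T = K"
  proof -
    define F where "F = mat_diag m (\<lambda>i. if i < q1 + q2 then (c (i + 1))\<^sup>2 else 0)"
    have F: "F \<in> carrier_mat m m" "F\<^sup>T = F" by (auto simp: F_def mat_diag_def)
    show ?thesis unfolding K_eq F_def[symmetric]
      using carrier_matD[OF gd(5)] carrier_matD[OF F(1)] by (simp add: mat_mult_transpose mat_mult_assoc F(2))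
  qed
  note gg = gGKB A Mc Mt Nc[unfolded N_def] MNA[unfolded N_def]
  have pos: "\<alpha> i \<noteq> 0 \<and> \<beta> i \<noteq> 0" if "i \<in> {1..kt}" for i
    using gGKB_terminate_step(1)[OF gg kt(1) that] .
  note sv = compact_SVD_vectors[OF svd bidiag_dim(3), folded B_def y_def h_def]
  have d: "dim_row A = m" "dim_col A = n" "dim_row N = n" "dim_col N = n" "dim_row U = m" "dim_col U = kt + 1"
    "dim_row V = n" "dim_col V = kt" "dim_row B = kt + 1" "dim_col B = kt"
    using A Nc by (auto simp: U_def V_def B_def)
  have AV: "A * V = U * B" unfolding V_def U_def B_def by (rule gGKB_matrix_A[OF gg])
  have NU: "N * A\<^sup>T * U = V * B\<^sup>T" unfolding V_def U_def B_def N_def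
    by (rule gGKB_matrix_pinv[OF gg]) (rule gGKB_terminate_step(2)[OF gg kt(1)])
  have UU: "U\<^sup>T * U = mat_diag (kt + 1) (\<lambda>i. if \<beta> (i + 1) = 0 then 0 else 1)"
    unfolding U_def by (rule gGKB_gram_u[OF gg pos])
  have U0: "col U 0 = u 1"
    unfolding U_def using col_seq_mat[of 0 "kt + 1" u m] gGKB_carrier(1)[OF gg, of 1] by simp
  have b_eq: "b = \<beta> 1 \<cdot>\<^sub>v u 1" using gGKB by (simp add: gGKB_def)
  have u1: "u 1 \<in> carrier_vec m" using gGKB_carrier(1)[OF gg, of 1] by simp
  have \<beta>1: "\<beta> 1 \<noteq> 0" using pos[of 1] kt(2) by simp
  have wc: "w i \<in> carrier_vec m" and xc: "x i \<in> carrier_vec n" if "i \<in> {1..kt}" for i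
    using d by (auto simp: w_def x_def intro: carrier_vecI)
  have dy: "dim_vec (y i) = kt + 1" "dim_vec (h i) = kt" if "i \<in> {1..kt}" for i
    using sv(1,2)[OF that] by auto
  \<comment> \<open>If the last column of \<open>U\<close> is zero, so is the last row of
    \<open>B\<close>; then \<theta> y = B h forces the last entry of \<open>y\<close> to vanish, and
    \<open>U\<close> acts on \<open>y\<close> as an isometry.\<close>
  have UUy: "U\<^sup>T *\<^sub>v (U *\<^sub>v y i) = y i" if i: "i \<in> {1..kt}" for i
  proof -
    have "U\<^sup>T *\<^sub>v (U *\<^sub>v y i) = (U\<^sup>T * U) *\<^sub>v y i" using d dy[OF i] by (simp add: mat_vec_assoc)
    also have "\<dots> = y i"
    proof (rule eq_vecI)
      fix j assume "j < dim_vec (y i)"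
      then have j: "j < kt + 1" using dy[OF i] by simp
      have "y i $ j = 0" if "\<beta> (j + 1) = 0"
      proof -
        have j': "j = kt" using pos[of "j + 1"] that j by (cases "j < kt") auto
        have "\<theta> i * y i $ j = (B *\<^sub>v h i) $ j" using sv(5)[OF i] dy[OF i] j by simp
        also have "\<dots> = 0" unfolding B_def using that j' by (subst bidiag_mult_vec[OF sv(2)[OF i]]) auto
        finally show ?thesis using sv(7)[OF i] by simp
      qed
      then show "((U\<^sup>T * U) *\<^sub>v y i) $ j = y i $ j"
        unfolding UU mat_diag_mult_vec[OF sv(1)[OF i] j] by simp
    qed (use dy[OF i] d in simp)
    finally show ?thesis .
  qed
  have w1: "w i \<bullet> w i = 1" if i: "i \<in> {1..kt}" for i
    using UUy[OF i] sv(3)[OF i] dy[OF i] d by (simp add: w_def mat_vec_adjoint)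
  have Ax: "A *\<^sub>v x i = \<theta> i \<cdot>\<^sub>v w i" if i: "i \<in> {1..kt}" for i
  proof -
    have "A *\<^sub>v x i = (A * V) *\<^sub>v h i" using d dy[OF i] by (simp add: x_def mat_vec_assoc)
    also have "\<dots> = U *\<^sub>v (B *\<^sub>v h i)" unfolding AV using d dy[OF i] by (simp add: mat_vec_assoc)
    also have "\<dots> = \<theta> i \<cdot>\<^sub>v w i" unfolding sv(5)[OF i] w_def
      by (rule mult_mat_vec[of _ m "kt + 1"]) (use d sv(1)[OF i] in \<open>auto intro: carrier_matI\<close>)
    finally show ?thesis .
  qed
  have Nw: "N *\<^sub>v (A\<^sup>T *\<^sub>v w i) = \<theta> i \<cdot>\<^sub>v x i" if i: "i \<in> {1..kt}" for i
  proof -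
    have "N *\<^sub>v (A\<^sup>T *\<^sub>v w i) = (N * A\<^sup>T * U) *\<^sub>v y i" using d dy[OF i] by (simp add: w_def mat_vec_assoc)
    also have "\<dots> = V *\<^sub>v (B\<^sup>T *\<^sub>v y i)" unfolding NU using d dy[OF i] by (simp add: mat_vec_assoc)
    also have "\<dots> = \<theta> i \<cdot>\<^sub>v x i" unfolding sv(6)[OF i] x_def
      by (rule mult_mat_vec[of _ n kt]) (use d sv(2)[OF i] in \<open>auto intro: carrier_matI\<close>)
    finally show ?thesis .
  qed
  have Kw: "K *\<^sub>v w i = (\<theta> i)\<^sup>2 \<cdot>\<^sub>v w i" if i: "i \<in> {1..kt}" for i
  proof -
    have "K *\<^sub>v w i = A *\<^sub>v (\<theta> i \<cdot>\<^sub>v x i)"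
      using d wc[OF i] by (simp add: K_def mat_vec_assoc Nw[OF i])
    also have "\<dots> = \<theta> i \<cdot>\<^sub>v (A *\<^sub>v x i)" by (rule mult_mat_vec[OF A xc[OF i]])
    finally show ?thesis by (simp add: Ax[OF i] smult_smult_assoc power2_eq_square)
  qed
  have out_eq: "out i = (\<theta> i, sqrt (1 - (\<theta> i)\<^sup>2), w i, x i)" if "i \<in> {1..kt}" for i
    unfolding out[OF that] gGKB_GSVD_tuple_def w_def x_def U_def V_def y_def h_def ..
  have w_ne: "w i \<noteq> 0\<^sub>v m" if i: "i \<in> {1..kt}" for i
    using w1[OF i] by (auto simp: scalar_prod_def)
  have "\<exists>j\<in>{1..l}. \<theta> i = \<sigma> j" if i: "i \<in> {1..kt}" for i
  proof -
    obtain e where "e < q1 + q2" "c (e + 1) = \<theta> i"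
      using GSVD_eigenvector_in_pA_span(2)[OF gsvd wc[OF i] _ sv(7)[OF i] w_ne[OF i]] Kw[OF i]
      unfolding K_def N_def M by blast
    then have "\<theta> i \<in> {c i | i. i \<in> {1..r} \<and> 0 < c i}"
      using gd sv(7)[OF i] by (intro CollectI exI[of _ "e + 1"]) auto
    then show ?thesis unfolding sigma_vals[symmetric] by auto
  qed
  then obtain \<tau> where \<tau>: "\<And>i. i \<in> {1..kt} \<Longrightarrow> \<tau> i \<in> {1..l} \<and> \<theta> i = \<sigma> (\<tau> i)" by metis
  have wG: "w i \<in> G (\<tau> i)" if i: "i \<in> {1..kt}" for i
    using GSVD_eigenvector_in_pA_span(1)[OF gsvd wc[OF i] _ sv(7)[OF i]] Kw[OF i] \<tau>[OF i] G[of "\<tau> i"]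
    unfolding K_def N_def M by simp
  have \<sigma>_pos: "0 < \<sigma> j" if "j \<in> {1..l}" for j
  proof -
    have "\<sigma> j \<in> {c i | i. i \<in> {1..r} \<and> 0 < c i}" unfolding sigma_vals[symmetric] using that by simp
    then show ?thesis by auto
  qed
  have proj: "G j \<subseteq> carrier_vec m" "proj_onto (G j) b \<in> G j" "\<And>g. g \<in> G j \<Longrightarrow> (b - proj_onto (G j) b) \<bullet> g = 0"
    if j: "j \<in> {1..l}" for j
    using GSVD_proj[OF gsvd \<sigma>_pos[OF j] b(1)] unfolding G[OF j] by auto
  have db: "dim_vec b = m" using b by simp
  have \<tau>J: "\<tau> i \<in> J" if i: "i \<in> {1..kt}" for i
  proof -
    have j: "\<tau> i \<in> {1..l}" using \<tau>[OF i] by simp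
    \<comment> \<open>As \<open>b\<close> is a nonzero multiple of \<open>u 1\<close>, the overlap
      of \<open>b\<close> with \<open>w i\<close> is governed by the first entry of the singular
      vector.\<close>
    have "u 1 \<bullet> w i = y i $ 0"
    proof -
      have "(U\<^sup>T *\<^sub>v w i) $ 0 = u 1 \<bullet> w i" using d by (simp add: U0)
      then show ?thesis using UUy[OF i] by (simp add: w_def)
    qed
    moreover have "y i $ 0 \<noteq> 0"
    proof (rule bidiag_singular_vector_first[OF sv(2)[OF i] _ sv(1)[OF i] _ _ _ pos])
      show "h i \<noteq> 0\<^sub>v kt" using sv(4)[OF i] by (auto simp: scalar_prod_def)
      show "\<theta> i \<noteq> 0" using sv(7)[OF i] by simp
      show "bidiag kt \<alpha> \<beta> *\<^sub>v h i = \<theta> i \<cdot>\<^sub>v y i" "(bidiag kt \<alpha> \<beta>)\<^sup>T *\<^sub>v y i = \<theta> i \<cdot>\<^sub>v h i"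
        using sv(5,6)[OF i] by (simp_all add: B_def)
    qed
    moreover have "b \<bullet> w i = \<beta> 1 * (u 1 \<bullet> w i)"
      using u1 wc[OF i] by (simp add: b_eq)
    ultimately have "b \<bullet> w i \<noteq> 0" using \<beta>1 by simp
    moreover have "b \<bullet> w i = proj_onto (G (\<tau> i)) b \<bullet> w i"
      using proj(1,2)[OF j] proj(3)[OF j wG[OF i]] wc[OF i] db by (force simp: scalar_prod_minus_left)
    ultimately have "proj_onto (G (\<tau> i)) b \<noteq> 0\<^sub>v m" using wc[OF i] by auto
    then show ?thesis using j by (simp add: J)
  qed
  have \<tau>_surj: "\<exists>i\<in>{1..kt}. \<tau> i = j" if "j \<in> J" for j
  proof (rule ccontr)
    assume no: "\<not> ?thesis"
    have j: "j \<in> {1..l}" using that by (simp add: J)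
    define g where "g = proj_onto (G j) b"
    have g: "g \<in> G j" "g \<in> carrier_vec m" "g \<noteq> 0\<^sub>v m"
      using proj[OF j] that by (auto simp: g_def J)
    have dg: "dim_vec g = m" using g by simp
    have "g \<bullet> g \<noteq> 0" using scalar_prod_self_eq_0[OF _ g(2)] g(3) by blast
    moreover have "b \<bullet> g = g \<bullet> g"
      using proj(3)[OF j g(1)] dg db by (simp add: g_def[symmetric] scalar_prod_minus_left)
    moreover have "b \<bullet> g = \<beta> 1 * (u 1 \<bullet> g)"
      using u1 g by (simp add: b_eq)
    ultimately have u1g: "u 1 \<bullet> g \<noteq> 0" by auto
    have Kg: "K *\<^sub>v g = (\<sigma> j)\<^sup>2 \<cdot>\<^sub>v g"
      using GSVD_pA_span_eigenvector[OF gsvd \<sigma>_pos[OF j]] g(1) G[OF j] unfolding K_def N_def M by simp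
    define z where "z = U\<^sup>T *\<^sub>v g"
    have z: "z \<in> carrier_vec (kt + 1)" using d by (auto simp: z_def intro: carrier_vecI)
    have "y i \<bullet> z = 0" if i: "i \<in> {1..kt}" for i
    proof -
      have ne: "\<theta> i \<noteq> \<sigma> j"
        using no i \<tau>[OF i] sigma_inj j by (metis inj_onD)
      have dK: "dim_row K = m" "dim_col K = m" using d by (simp_all add: K_def)
      \<comment> \<open>Eigenvectors of the symmetric \<open>K\<close> for different eigenvalues are
        orthogonal; the eigenvalues differ because \<open>\<tau>\<close> misses
        \<open>j\<close>.\<close>
      have "(K *\<^sub>v w i) \<bullet> g = w i \<bullet> (K *\<^sub>v g)"
        using dK wc[OF i] dg by (simp add: mat_vec_adjoint KT)
      then have "(\<theta> i)\<^sup>2 * (w i \<bullet> g) = (\<sigma> j)\<^sup>2 * (w i \<bullet> g)"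
        using wc[OF i] g(2) by (simp add: Kw[OF i] Kg)
      moreover have "(\<theta> i)\<^sup>2 \<noteq> (\<sigma> j)\<^sup>2" using ne sv(7)[OF i] \<sigma>_pos[OF j] by (simp add: power2_eq_iff)
      ultimately have "w i \<bullet> g = 0" by simp
      then show ?thesis using d dy[OF i] dg by (simp add: w_def z_def mat_vec_adjoint)
    qed
    then have "B\<^sup>T *\<^sub>v z = 0\<^sub>v kt" by (rule sv(9)[OF z])
    \<comment> \<open>Transposing \<open>N * A\<^sup>T * U = V * B\<^sup>T\<close> turns this into \<open>U\<^sup>T K g = 0\<close>, although \<open>K g\<close> is a nonzero
      multiple of \<open>g\<close> and \<open>u 1 \<bullet> g \<noteq> 0\<close>.\<close>
    then have "(A * V)\<^sup>T *\<^sub>v g = 0\<^sub>v kt" unfolding AV using d dg by (simp add: mat_mult_transpose mat_vec_assoc z_def)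
    then have VAg: "V\<^sup>T *\<^sub>v (A\<^sup>T *\<^sub>v g) = 0\<^sub>v kt" using d dg by (simp add: mat_mult_transpose mat_vec_assoc)
    have "U\<^sup>T *\<^sub>v (K\<^sup>T *\<^sub>v g) = (N * A\<^sup>T * U)\<^sup>T *\<^sub>v (A\<^sup>T *\<^sub>v g)"
      using d dg by (simp add: K_def mat_mult_transpose mat_vec_assoc)
    also have "\<dots> = B *\<^sub>v (V\<^sup>T *\<^sub>v (A\<^sup>T *\<^sub>v g))" unfolding NU using d dg by (simp add: mat_mult_transpose mat_vec_assoc)
    also have "\<dots> = 0\<^sub>v (kt + 1)" unfolding VAg using d by (simp add: mat_vec_zero)
    finally have "U\<^sup>T *\<^sub>v (K\<^sup>T *\<^sub>v g) = 0\<^sub>v (kt + 1)" .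
    moreover note KT
    moreover have "(U\<^sup>T *\<^sub>v ((\<sigma> j)\<^sup>2 \<cdot>\<^sub>v g)) $ 0 = (\<sigma> j)\<^sup>2 * (u 1 \<bullet> g)"
      using d u1 g(2) by (simp add: U0)
    ultimately have "(\<sigma> j)\<^sup>2 * (u 1 \<bullet> g) = 0" by (simp add: Kg)
    then show False using u1g \<sigma>_pos[OF j] by simp
  qed
  have "bij_betw \<tau> {1..kt} J"
  proof (rule bij_betw_imageI)
    show "inj_on \<tau> {1..kt}" using sv(8) \<tau> by (metis inj_on_def)
    show "\<tau> ` {1..kt} = J" using \<tau>J \<tau>_surj by blast
  qed
  moreover have "\<forall>i\<in>{1..kt}. case out i of (cbar, sbar, pbar, xbar) \<Rightarrow> cbar = \<sigma> (\<tau> i) \<and> pbar \<in> G (\<tau> i)"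
    using \<tau> wG by (simp add: out_eq)
  moreover have "exact_nontrivial_GSVD_components m p n r A L (out ` {1..kt})"
  proof -
    have "out ` {1..kt} = (\<lambda>i. (\<theta> i, sqrt (1 - (\<theta> i)\<^sup>2), w i, x i)) ` {1..kt}"
      by (rule image_cong) (simp_all add: out_eq)
    then show ?thesis
      using exact_nontrivial_GSVD_componentsI[OF gsvd M wc w1 xc sv(7) sv(8) Ax Nw[unfolded N_def]] by simp
  qed
  ultimately show ?thesis by blast
qed

end
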